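(* Let $\{\mathcal{P}_{s,t}\}_{s\le t}$ be the transfer operator family of the $\tau$-periodically driven SDE $dx_t=v(t,x_t)\,dt+\varepsilon\,dw_t$ on $X$, and let $\boldsymbol{\mathcal{G}}$ be the associated augmented generator. If $\boldsymbol{\mathcal{G}}\boldsymbol{f}=\mu\boldsymbol{f}$ for some $\mu\in\mathbb{C}$, then $$\boldsymbol{f}(s+t\bmod\tau,\cdot)=e^{-\mu t}\,\mathcal{P}_{s,s+t}\,\boldsymbol{f}(s,\cdot)\qquad\text{for } s\in\tau S^1,\ t\ge0.$$ In particular, with $f_s:=\boldsymbol{f}(s,\cdot)$, $\mathcal{P}_{s,s+\tau}f_s=e^{\mu\tau}f_s$, i.e. the time-slices of $\boldsymbol{f}$ are eigenfunctions of $\mathcal{P}_{s,s+\tau}$ for the corresponding $s\in\tau S^1$.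
   Context: Standing assumptions: $S^1$ is the circle of unit circumference and $\tau S^1$ is identified with $[0,\tau)$. $X$ is a bounded domain in $\mathbb{R}^d$, uniformly regular of class $C^4$ (in particular its boundary is a $C^4$-manifold). The time-periodic vector field $v:\tau S^1\times\overline X\to\mathbb{R}^d$ satisfies $v(\theta,\cdot)\in C^1(\overline X,\mathbb{R}^d)$ for every $\theta$, $\theta\mapsto v(\theta,x)$ is in $C^1(\tau S^1,\mathbb{R}^d)$ for every $x\in\overline X$, $v(\theta,\cdot)$ is divergence-free for all $\theta$, and $v$ is tangential to $\partial X$ on $\partial X$ for all times. $\{w_t\}$ is a $d$-dimensional standard Wiener process, $\varepsilon>0$, and the process has reflecting boundary conditions at $\partial X$. Transfer operator: with $q_{s,t}(y,z)$ the transition density of the process from time $s$ to time $t$ with respect to Lebesgue measure $m$, $\mathcal{P}_{s,t}f=\int_Xq_{s,t}(y,\cdot)f(y)\,dm(y)$; it is the evolution family of the Fokker--Planck equation $\partial_tu_t=\mathcal{G}_tu_t$. $\mathcal{G}_\theta$ is the infinitesimal generator, on $L^r(X)$ for some $1\le r<\infty$, of the transfer operator semigroup of the time-homogeneous SDE with frozen drift $v_\theta=v(\theta,\cdot)$ and reflecting boundary; it acts as $\mathcal{G}_\theta f=\frac{\varepsilon^2}{2}\Delta f-\mathrm{div}(fv_\theta)$ with the Neumann condition $\partial f/\partial n=0$ on $\partial X$. Augmented generator: the generator of the transfer operator semigroup of the augmented process $d\theta_t=dt$, $dx_t=v(\theta_t,x_t)\,dt+\varepsilon\,dw_t$ on $\tau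 S^1\times X$. For a function $\boldsymbol{f}(\theta,x)$ with time-slices $f_\theta:=\boldsymbol{f}(\theta,\cdot)$, $$\boldsymbol{\mathcal{G}}\boldsymbol{f}(\theta,x)=-\partial_\theta\boldsymbol{f}(\theta,x)+\mathcal{G}_\theta f_\theta(x),$$ with domain containing $\{\boldsymbol{f}:\ \theta\mapsto f_\theta\in C^1(\tau S^1,L^r),\ f_\theta\in D(\mathcal{G}_\theta)\ \forall\theta\in\tau S^1\}$. *)

theory Defs
  imports "HOL-Probability.Probability" "HOL-Library.Real_Mod"
begin

section \<open>The domain\<close>

text \<open>For open \<open>S\<close>, this is the usual class $C^k(S)$: all partial derivatives up to order \<open>k\<close>
  exist and are continuous.\<close>

primrec Ck_on :: "nat \<Rightarrow> 'a::euclidean_space set \<Rightarrow> ('a \<Rightarrow> 'b::real_normed_vector) \<Rightarrow> bool" where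
  "Ck_on 0 S f \<longleftrightarrow> continuous_on S f"
| "Ck_on (Suc k) S f \<longleftrightarrow> (\<forall>x\<in>S. f differentiable (at x)) \<and>
     (\<forall>i\<in>Basis. Ck_on k S (\<lambda>x. frechet_derivative f (at x) i))"

text \<open>Each boundary point has a neighbourhood that a \<open>C\<^sup>k\<close> diffeomorphism maps to the unit ball,
  the part inside \<open>X\<close> becoming an open half ball.  The boundary of a bounded \<open>X\<close> is compact, so
  finitely many (shrunken) charts suffice and the bounds required by \<^emph>\<open>uniform\<close> regularity
  are automatic.\<close>

definition Ck_regular_domain :: "nat \<Rightarrow> 'a::euclidean_space set \<Rightarrow> bool" where
  "Ck_regular_domain k X \<longleftrightarrow> open X \<and> connected X \<and> X \<noteq> {} \<and>
     (\<forall>p\<in>frontier X. \<exists>U \<phi> \<psi>. \<exists>e\<in>Basis. open U \<and> p \<in> U \<and>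
        homeomorphism U (ball (0::'a) 1) \<phi> \<psi> \<and> Ck_on k U \<phi> \<and> Ck_on k (ball 0 1) \<psi> \<and>
        \<phi> ` (U \<inter> X) = {z \<in> ball 0 1. z \<bullet> e > 0})"

text \<open>At a boundary point of a \<open>C\<^sup>1\<close> domain exactly one unit vector has this property: the open
  half space \<open>w \<bullet> n < 0\<close> consists of directions pointing into \<open>X\<close>, and \<open>w \<bullet> n > 0\<close> of
  directions pointing out of its closure.\<close>

definition is_outward_unit_normal :: "'a::euclidean_space set \<Rightarrow> 'a \<Rightarrow> 'a \<Rightarrow> bool" where
  "is_outward_unit_normal X p n \<longleftrightarrow> norm n = 1 \<and>
     (\<forall>w. w \<bullet> n < 0 \<longrightarrow> (\<forall>\<^sub>F h in at_right 0. p + h *\<^sub>R w \<in> X)) \<and>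
     (\<forall>w. w \<bullet> n > 0 \<longrightarrow> (\<forall>\<^sub>F h in at_right 0. p + h *\<^sub>R w \<notin> closure X))"

definition outward_normal :: "'a::euclidean_space set \<Rightarrow> 'a \<Rightarrow> 'a" where
  "outward_normal X p = (THE n. is_outward_unit_normal X p n)"

section \<open>The velocity field\<close>

text \<open>\<open>C\<^sup>1\<close> up to the boundary of the open set \<open>X\<close>: the derivative extends continuously to the
  closure.\<close>

definition C1_on_closure ::
    "'a::euclidean_space set \<Rightarrow> ('a \<Rightarrow> 'b::real_normed_vector) \<Rightarrow> bool" where
  "C1_on_closure X g \<longleftrightarrow> continuous_on (closure X) g \<and>
     (\<exists>g' :: 'a \<Rightarrow> 'a \<Rightarrow>\<^sub>L 'b. (\<forall>x\<in>X. (g has_derivative blinfun_apply (g' x)) (at x)) \<and>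
        continuous_on (closure X) g')"

text \<open>Functions on the circle \<open>\<tau> S\<^sup>1\<close> are \<open>\<tau>\<close>-periodic functions of a real variable here.\<close>

definition admissible_field ::
    "real \<Rightarrow> 'a::euclidean_space set \<Rightarrow> (real \<Rightarrow> 'a \<Rightarrow> 'a) \<Rightarrow> bool" where
  "admissible_field \<tau> X v \<longleftrightarrow>
     (\<forall>t x. v (t + \<tau>) x = v t x) \<and>
     (\<forall>t. C1_on_closure X (v t)) \<and>
     (\<forall>x\<in>closure X. (\<lambda>t. v t x) C1_differentiable_on UNIV) \<and>
     (\<forall>t. \<forall>x\<in>X. (\<Sum>i\<in>Basis. frechet_derivative (v t) (at x) i \<bullet> i) = 0) \<and>
     (\<forall>t. \<forall>p\<in>frontier X. v t p \<bullet> outward_normal X p = 0)"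

section \<open>The reflected stochastic differential equation\<close>

text \<open>A standard \<open>d\<close>-dimensional Wiener process on the time axis \<open>[0, \<infinity>)\<close>, relative to a filtration
  whose negative times play no role.\<close>

definition standard_wiener_process ::
    "'w measure \<Rightarrow> (real \<Rightarrow> 'w measure) \<Rightarrow> (real \<Rightarrow> 'w \<Rightarrow> 'a::euclidean_space) \<Rightarrow> bool" where
  "standard_wiener_process M F w \<longleftrightarrow>
     prob_space M \<and> filtration (space M) F \<and> (\<forall>t. subalgebra M (F t)) \<and>
     (\<forall>t\<ge>0. w t \<in> borel_measurable (F t)) \<and>
     (AE \<omega> in M. w 0 \<omega> = 0) \<and>
     (\<forall>\<omega>\<in>space M. continuous_on {0..} (\<lambda>t. w t \<omega>)) \<and>
     (\<forall>s t. 0 \<le> s \<and> s < t \<longrightarrow>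
        prob_space.indep_set M (sets (F s))
          (sets (vimage_algebra (space M) (\<lambda>\<omega>. w t \<omega> - w s \<omega>) borel)) \<and>
        prob_space.indep_vars M (\<lambda>_. borel) (\<lambda>i \<omega>. (w t \<omega> - w s \<omega>) \<bullet> i) Basis \<and>
        (\<forall>i\<in>Basis. distributed M lborel (\<lambda>\<omega>. (w t \<omega> - w s \<omega>) \<bullet> i)
           (\<lambda>z. ennreal (normal_density 0 (sqrt (t - s)) z))))"

text \<open>The solution \<open>x\<close> of $dx_t = b(t,x_t)\,dt + \varepsilon\,dw_t$ with \<open>x\<^sub>s = y\<close> and (normal)
  reflection at the boundary of \<open>X\<close>, in Skorokhod's formulation
  $dx_t = b(t,x_t)\,dt + \varepsilon\,dw_t - n(x_t)\,dl_t$, where the local time \<open>l\<close> increases only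
  while \<open>x\<close> is on the boundary.  The noise being additive, no stochastic integral is involved; the
  integral against \<open>l\<close> is a pathwise Lebesgue-Stieltjes integral.\<close>

definition reflected_solution ::
    "'w measure \<Rightarrow> (real \<Rightarrow> 'w measure) \<Rightarrow> (real \<Rightarrow> 'w \<Rightarrow> 'a::euclidean_space) \<Rightarrow> 'a set \<Rightarrow>
     (real \<Rightarrow> 'a \<Rightarrow> 'a) \<Rightarrow> real \<Rightarrow> real \<Rightarrow> 'a \<Rightarrow> (real \<Rightarrow> 'w \<Rightarrow> 'a) \<Rightarrow> bool" where
  "reflected_solution M F w X b \<epsilon> s y x \<longleftrightarrow>
     (\<forall>t\<ge>s. x t \<in> borel_measurable (F t)) \<and>
     (\<exists>l :: real \<Rightarrow> 'w \<Rightarrow> real. (\<forall>t\<ge>s. l t \<in> borel_measurable (F t)) \<and>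
       (AE \<omega> in M.
          continuous_on {s..} (\<lambda>t. x t \<omega>) \<and> (\<forall>t\<ge>s. x t \<omega> \<in> closure X) \<and>
          continuous_on UNIV (\<lambda>t. l t \<omega>) \<and> mono (\<lambda>t. l t \<omega>) \<and> (\<forall>t\<le>s. l t \<omega> = 0) \<and>
          (AE t in interval_measure (\<lambda>t. l t \<omega>). x t \<omega> \<in> frontier X) \<and>
          (\<forall>t\<ge>s. (\<lambda>a. b a (x a \<omega>)) absolutely_integrable_on {s..t} \<and>
             x t \<omega> = y + integral {s..t} (\<lambda>a. b a (x a \<omega>)) + \<epsilon> *\<^sub>R (w t \<omega> - w s \<omega>)
               - (LINT a:{s..t}|interval_measure (\<lambda>t. l t \<omega>). outward_normal X (x a \<omega>)))))"

text \<open>\<open>q s t y z\<close> is the density at \<open>z\<close> of the state at time \<open>t\<close> of the process started in \<open>y\<close> at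
  time \<open>s\<close>.\<close>

definition transition_density ::
    "'w measure \<Rightarrow> (real \<Rightarrow> 'w measure) \<Rightarrow> (real \<Rightarrow> 'w \<Rightarrow> 'a::euclidean_space) \<Rightarrow> 'a set \<Rightarrow>
     (real \<Rightarrow> 'a \<Rightarrow> 'a) \<Rightarrow> real \<Rightarrow> (real \<Rightarrow> real \<Rightarrow> 'a \<Rightarrow> 'a \<Rightarrow> real) \<Rightarrow> bool" where
  "transition_density M F w X b \<epsilon> q \<longleftrightarrow>
     set_borel_measurable borel {(s, t, y, z). 0 \<le> s \<and> s < t \<and> y \<in> X \<and> z \<in> X}
       (\<lambda>(s, t, y, z). q s t y z) \<and>
     (\<forall>s t. \<forall>y\<in>X. \<forall>z\<in>X. 0 \<le> s \<and> s < t \<longrightarrow> 0 \<le> q s t y z) \<and>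
     (\<forall>s\<ge>0. \<forall>y\<in>X. (\<exists>x. reflected_solution M F w X b \<epsilon> s y x) \<and>
        (\<forall>x. reflected_solution M F w X b \<epsilon> s y x \<longrightarrow>
           (\<forall>t>s. distributed M lborel (x t) (\<lambda>z. ennreal (q s t y z) * indicator X z))))"

section \<open>Lebesgue spaces\<close>

text \<open>Elements of $L^r$ are represented by measurable functions; equality in $L^r$ is equality
  almost everywhere.\<close>

definition Lr_space :: "'b measure \<Rightarrow> real \<Rightarrow> ('b \<Rightarrow> complex) set" where
  "Lr_space M r = {f \<in> borel_measurable M. integrable M (\<lambda>x. cmod (f x) powr r)}"

definition Lr_norm :: "'b measure \<Rightarrow> real \<Rightarrow> ('b \<Rightarrow> complex) \<Rightarrow> real" where
  "Lr_norm M r f = (LINT x|M. cmod (f x) powr r) powr (1 / r)"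

text \<open>Convergence in $L^r$.  Membership is required explicitly because the Bochner integral of a
  non-integrable function is \<open>0\<close>.\<close>

definition Lr_tendsto ::
    "'b measure \<Rightarrow> real \<Rightarrow> ('c \<Rightarrow> 'b \<Rightarrow> complex) \<Rightarrow> ('b \<Rightarrow> complex) \<Rightarrow> 'c filter \<Rightarrow> bool" where
  "Lr_tendsto M r u l A \<longleftrightarrow> l \<in> Lr_space M r \<and> (\<forall>\<^sub>F h in A. u h \<in> Lr_space M r) \<and>
     ((\<lambda>h. Lr_norm M r (\<lambda>x. u h x - l x)) \<longlongrightarrow> 0) A"

abbreviation leb_on :: "'a::euclidean_space set \<Rightarrow> 'a measure" where
  "leb_on X \<equiv> restrict_space lborel X"

section \<open>Transfer operators and generators\<close>

text \<open>For \<open>t = s\<close> the transition kernel is the Dirac measure, which has no density; the transfer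
  operator is the identity.\<close>

definition transfer_op ::
    "'a::euclidean_space set \<Rightarrow> (real \<Rightarrow> real \<Rightarrow> 'a \<Rightarrow> 'a \<Rightarrow> real) \<Rightarrow> real \<Rightarrow> real \<Rightarrow>
     ('a \<Rightarrow> complex) \<Rightarrow> 'a \<Rightarrow> complex" where
  "transfer_op X q s t f =
     (if s = t then f else (\<lambda>z. LINT y:X|lborel. complex_of_real (q s t y z) * f y))"

text \<open>Infinitesimal generator on $L^r$ of an operator semigroup \<open>T\<close>, as a graph: \<open>f\<close> is in its
  domain and is mapped to \<open>g\<close>.\<close>

definition generates ::
    "'b measure \<Rightarrow> real \<Rightarrow> (real \<Rightarrow> ('b \<Rightarrow> complex) \<Rightarrow> 'b \<Rightarrow> complex) \<Rightarrow>
     ('b \<Rightarrow> complex) \<Rightarrow> ('b \<Rightarrow> complex) \<Rightarrow> bool" where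
  "generates M r T f g \<longleftrightarrow> f \<in> Lr_space M r \<and>
     Lr_tendsto M r (\<lambda>h x. (T h f x - f x) / of_real h) g (at_right 0)"

text \<open>The generators \<open>\<G>\<^sub>\<theta>\<close>, where \<open>qf \<theta>\<close> is the transition density of the process with drift frozen
  at time \<open>\<theta>\<close>; by time-homogeneity its semigroup may be read off from the starting time \<open>0\<close>.\<close>

definition frozen_generator ::
    "real \<Rightarrow> 'a::euclidean_space set \<Rightarrow> (real \<Rightarrow> real \<Rightarrow> real \<Rightarrow> 'a \<Rightarrow> 'a \<Rightarrow> real) \<Rightarrow> real \<Rightarrow>
     ('a \<Rightarrow> complex) \<Rightarrow> ('a \<Rightarrow> complex) \<Rightarrow> bool" where
  "frozen_generator r X qf \<theta> = generates (leb_on X) r (\<lambda>t. transfer_op X (qf \<theta>) 0 t)"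

text \<open>\<open>U\<close> is the (parabolic) evolution family on $L^r$ of the nonautonomous equation
  $\partial_t u_t = A_t u_t$, \<open>t \<ge> 0\<close>, in the sense of Pazy, Amann and Lunardi: a strongly continuous,
  locally uniformly bounded family of linear operators with the cocycle property, with
  $\partial_t U_{s,t} f = A_t U_{s,t} f$ for all \<open>f\<close>, and
  $\partial_s U_{s,t} f = - U_{s,t} A_s f$ for \<open>f\<close> in the domain of \<open>A s\<close>.\<close>

definition evolution_family ::
    "'b measure \<Rightarrow> real \<Rightarrow> (real \<Rightarrow> ('b \<Rightarrow> complex) \<Rightarrow> ('b \<Rightarrow> complex) \<Rightarrow> bool) \<Rightarrow>
     (real \<Rightarrow> real \<Rightarrow> ('b \<Rightarrow> complex) \<Rightarrow> 'b \<Rightarrow> complex) \<Rightarrow> bool" where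
  "evolution_family M r A U \<longleftrightarrow>
     (\<forall>T. \<exists>C. \<forall>s t. \<forall>f\<in>Lr_space M r. 0 \<le> s \<and> s \<le> t \<and> t \<le> T \<longrightarrow>
        U s t f \<in> Lr_space M r \<and> Lr_norm M r (U s t f) \<le> C * Lr_norm M r f) \<and>
     (\<forall>s t a b. \<forall>f\<in>Lr_space M r. \<forall>g\<in>Lr_space M r. 0 \<le> s \<and> s \<le> t \<longrightarrow>
        (AE x in M. U s t (\<lambda>x. a * f x + b * g x) x = a * U s t f x + b * U s t g x)) \<and>
     (\<forall>s\<ge>0. \<forall>f\<in>Lr_space M r. AE x in M. U s s f x = f x) \<and>
     (\<forall>s t u. \<forall>f\<in>Lr_space M r. 0 \<le> s \<and> s \<le> t \<and> t \<le> u \<longrightarrow>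
        (AE x in M. U t u (U s t f) x = U s u f x)) \<and>
     (\<forall>s t. \<forall>f\<in>Lr_space M r. 0 \<le> s \<and> s \<le> t \<longrightarrow>
        Lr_tendsto M r (\<lambda>p. U (fst p) (snd p) f) (U s t f)
          (at (s, t) within {p. 0 \<le> fst p \<and> fst p \<le> snd p})) \<and>
     (\<forall>s t. \<forall>f\<in>Lr_space M r. 0 \<le> s \<and> s < t \<longrightarrow>
        (\<exists>g. A t (U s t f) g \<and>
           Lr_tendsto M r (\<lambda>h x. (U s (t + h) f x - U s t f x) / of_real h) g (at 0))) \<and>
     (\<forall>s t f g. 0 \<le> s \<and> s < t \<and> A s f g \<longrightarrow>
        Lr_tendsto M r (\<lambda>h x. (U (s + h) t f x - U s t f x) / of_real h) (\<lambda>x. - U s t g x)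
          (at 0 within {h. 0 \<le> s + h \<and> s + h \<le> t}))"

section \<open>The augmented process\<close>

text \<open>The circle \<open>\<tau> S\<^sup>1\<close> is represented by \<open>[0, \<tau>)\<close>; time-slices of \<open>f\<close> are the functions
  \<open>\<lambda>x. f (\<theta>, x)\<close>.\<close>

abbreviation augmented_space :: "real \<Rightarrow> 'a::euclidean_space set \<Rightarrow> (real \<times> 'a) measure" where
  "augmented_space \<tau> X \<equiv> leb_on {0..<\<tau>} \<Otimes>\<^sub>M leb_on X"

text \<open>The augmented process started in \<open>(s, y)\<close> is after time \<open>t\<close> in
  \<open>((s + t) mod \<tau>, x\<^sub>s\<^sub>+\<^sub>t)\<close>, where \<open>x\<close> starts in \<open>y\<close> at time \<open>s\<close>.  Hence mass on the slice \<open>\<theta>\<close>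
  originates from the slice \<open>s = (\<theta> - t) mod \<tau>\<close>, and on that slice the push-forward of densities is
  the transfer operator from time \<open>s\<close> to \<open>s + t\<close>.\<close>

definition augmented_transfer ::
    "real \<Rightarrow> (real \<Rightarrow> real \<Rightarrow> ('a \<Rightarrow> complex) \<Rightarrow> 'a \<Rightarrow> complex) \<Rightarrow> real \<Rightarrow>
     (real \<times> 'a \<Rightarrow> complex) \<Rightarrow> real \<times> 'a \<Rightarrow> complex" where
  "augmented_transfer \<tau> P t f = (\<lambda>(\<theta>, x).
     let s = (\<theta> - t) rmod \<tau> in P s (s + t) (\<lambda>y. f (s, y)) x)"

definition augmented_generator ::
    "real \<Rightarrow> real \<Rightarrow> 'a::euclidean_space set \<Rightarrow>
     (real \<Rightarrow> real \<Rightarrow> ('a \<Rightarrow> complex) \<Rightarrow> 'a \<Rightarrow> complex) \<Rightarrow>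
     (real \<times> 'a \<Rightarrow> complex) \<Rightarrow> (real \<times> 'a \<Rightarrow> complex) \<Rightarrow> bool" where
  "augmented_generator r \<tau> X P = generates (augmented_space \<tau> X) r (augmented_transfer \<tau> P)"

definition slices_continuous ::
    "real \<Rightarrow> real \<Rightarrow> 'a::euclidean_space set \<Rightarrow> (real \<times> 'a \<Rightarrow> complex) \<Rightarrow> bool" where
  "slices_continuous r \<tau> X f \<longleftrightarrow>
     (\<forall>\<theta>. Lr_tendsto (leb_on X) r (\<lambda>\<eta> x. f (\<eta> rmod \<tau>, x)) (\<lambda>x. f (\<theta> rmod \<tau>, x)) (at \<theta>))"

text \<open>\<open>\<theta> \<mapsto> f\<^sub>\<theta>\<close> is in $C^1(\tau S^1, L^r)$ with derivative \<open>f'\<close>.\<close>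

definition slices_C1 ::
    "real \<Rightarrow> real \<Rightarrow> 'a::euclidean_space set \<Rightarrow> (real \<times> 'a \<Rightarrow> complex) \<Rightarrow>
     (real \<times> 'a \<Rightarrow> complex) \<Rightarrow> bool" where
  "slices_C1 r \<tau> X f f' \<longleftrightarrow>
     (\<forall>\<theta>\<in>{0..<\<tau>}. (\<lambda>x. f (\<theta>, x)) \<in> Lr_space (leb_on X) r) \<and>
     (\<forall>\<theta>. Lr_tendsto (leb_on X) r
        (\<lambda>h x. (f ((\<theta> + h) rmod \<tau>, x) - f (\<theta> rmod \<tau>, x)) / of_real h)
        (\<lambda>x. f' (\<theta> rmod \<tau>, x)) (at 0)) \<and>
     slices_continuous r \<tau> X f'"

text \<open>The explicit form $g(\theta,\cdot) = -\partial_\theta f(\theta,\cdot) + \mathcal{G}_\theta f_\theta$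
  of the augmented generator, on the functions \<open>f\<close> with $C^1$ slices in the domains of the
  \<open>G \<theta>\<close>.  No joint measurability of \<open>f\<close> in \<open>(\<theta>, x)\<close> is imposed.\<close>

definition classical_augmented_generator ::
    "real \<Rightarrow> real \<Rightarrow> 'a::euclidean_space set \<Rightarrow>
     (real \<Rightarrow> ('a \<Rightarrow> complex) \<Rightarrow> ('a \<Rightarrow> complex) \<Rightarrow> bool) \<Rightarrow>
     (real \<times> 'a \<Rightarrow> complex) \<Rightarrow> (real \<times> 'a \<Rightarrow> complex) \<Rightarrow> bool" where
  "classical_augmented_generator r \<tau> X G f g \<longleftrightarrow>
     (\<exists>f'. slices_C1 r \<tau> X f f' \<and>
       (\<forall>\<theta>\<in>{0..<\<tau>}. \<exists>k. G \<theta> (\<lambda>x. f (\<theta>, x)) k \<and>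
          (AE x in leb_on X. g (\<theta>, x) = - f' (\<theta>, x) + k x)))"

text \<open>An element of $L^r(\tau S^1 \times X)$ determines its slices only for almost every time.  A
  version with continuous slices, if there is one, fixes them (up to null sets of \<open>X\<close>) at every
  time.\<close>

definition continuous_version ::
    "real \<Rightarrow> real \<Rightarrow> 'a::euclidean_space set \<Rightarrow> (real \<times> 'a \<Rightarrow> complex) \<Rightarrow>
     (real \<times> 'a \<Rightarrow> complex) \<Rightarrow> bool" where
  "continuous_version r \<tau> X f g \<longleftrightarrow> g \<in> Lr_space (augmented_space \<tau> X) r \<and>
     (AE p in augmented_space \<tau> X. g p = f p) \<and> slices_continuous r \<tau> X g"

definition eigenslices ::
    "real \<Rightarrow> 'a::euclidean_space set \<Rightarrow>
     (real \<Rightarrow> real \<Rightarrow> ('a \<Rightarrow> complex) \<Rightarrow> 'a \<Rightarrow> complex) \<Rightarrow> complex \<Rightarrow>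
     (real \<times> 'a \<Rightarrow> complex) \<Rightarrow> bool" where
  "eigenslices \<tau> X P \<mu> f \<longleftrightarrow>
     (\<forall>s\<in>{0..<\<tau>}. \<forall>t\<ge>0. AE x in leb_on X.
        f ((s + t) rmod \<tau>, x) = exp (- \<mu> * of_real t) * P s (s + t) (\<lambda>y. f (s, y)) x) \<and>
     (\<forall>s\<in>{0..<\<tau>}. AE x in leb_on X.
        P s (s + \<tau>) (\<lambda>y. f (s, y)) x = exp (\<mu> * of_real \<tau>) * f (s, x)) \<and>
     ((\<exists>s\<in>{0..<\<tau>}. \<not> (AE x in leb_on X. f (s, x) = 0)) \<longrightarrow>
        (\<forall>s\<in>{0..<\<tau>}. \<not> (AE x in leb_on X. f (s, x) = 0)))"

end

theory Submission
  imports Defs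
begin

text \<open>If \<open>u\<^sub>t\<close> lies in the domain of \<open>A\<^sub>t\<close> and \<open>u' = A u - \<mu> u\<close>, then
  \<open>e\<^bsup>\<mu>t\<^esup> U\<^sub>t\<^sub>,\<^sub>b u\<^sub>t\<close> is constant in \<open>t\<close>, because the backward equation cancels the forward one.
  For \<open>\<mu> = 0\<close> this gives the \<open>\<tau>\<close>-periodicity of the evolution family, and for the slices of a
  classical eigenfunction it is the claim.

  For an eigenfunction of the abstract generator, one step of length \<open>h\<close> of the augmented semigroup
  differs from \<open>e\<^bsup>\<mu>h\<^esup> f\<close> by \<open>o(h)\<close> in $L^r$ of the product.  Summing these defects over the
  \<open>t/h\<close> steps of an orbit and integrating over the starting time shows that
  \<open>P\<^sub>s\<^sub>,\<^sub>s\<^sub>+\<^sub>t f\<^sub>s = e\<^bsup>\<mu>t\<^esup> f\<^sub>s\<^sub>+\<^sub>t\<close> for almost every \<open>s\<close>.  By Fubini some \<open>s\<close> is good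
  for almost every \<open>t\<close>, and \<open>e\<^bsup>-\<mu>t\<^esup> P\<^sub>s\<^sub>,\<^sub>s\<^sub>+\<^sub>t f\<^sub>s\<close> is then a version of \<open>f\<close> with
  continuous slices.  For any such version, continuity removes the exceptional times.\<close>

section \<open>Lebesgue spaces\<close>

text \<open>For positive \<open>x\<close> and \<open>y\<close> this is convexity of the power on the
  open half line; if one of them vanishes, it reduces to \<open>c powr r \<le> c\<close> for
  \<open>0 < c < 1\<close>.\<close>

lemma powr_weighted_mean_le:
  fixes x y p q r :: real
  assumes "1 \<le> r" "0 \<le> x" "0 \<le> y" "0 < p" "0 < q" "p + q = 1"
  shows "(p * x + q * y) powr r \<le> p * x powr r + q * y powr r"
proof -
  have le: "(c * z) powr r \<le> c * z powr r" if "0 < c" "c < 1" "0 \<le> z" for c z :: real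
  proof -
    have "c powr r \<le> c powr 1"
      using that assms(1) by (intro powr_mono') auto
    then show ?thesis
      using that by (simp add: powr_mult mult_right_mono)
  qed
  consider "x = 0" | "y = 0" | "x > 0" "y > 0"
    using assms by linarith
  then show ?thesis
  proof cases
    case 3
    have "convex_on {0<..} (\<lambda>x::real. x powr r)"
      using assms(1) by (rule powr_convex)
    from convex_onD[OF this, of q x y] have "((1 - q) * x + q * y) powr r \<le> (1 - q) * x powr r + q * y powr r"
      using assms 3 by simp
    moreover have "1 - q = p" using assms(6) by simp
    ultimately show ?thesis by simp
  qed (use assms le[of q y] le[of p x] in auto)
qed

locale Lebesgue_space =
  fixes M :: "'b measure" and r :: real
  assumes exponent: "1 \<le> r"
begin

abbreviation "L \<equiv> Lr_space M r"
abbreviation nm :: "('b \<Rightarrow> complex) \<Rightarrow> real" where "nm \<equiv> Lr_norm M r"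
abbreviation "tends \<equiv> Lr_tendsto M r"

lemma measurable_L [measurable_dest]: "f \<in> L \<Longrightarrow> f \<in> borel_measurable M"
  by (simp add: Lr_space_def)

lemma nm_nonneg [simp]: "0 \<le> nm f"
  by (simp add: Lr_norm_def)

lemma nm_cong_AE:
  assumes "f \<in> L" "g \<in> L" "AE x in M. f x = g x"
  shows "nm f = nm g"
  unfolding Lr_norm_def
  by (rule arg_cong[where f = "\<lambda>a. a powr (1 / r)"], rule integral_cong_AE)
    (use assms in \<open>auto dest: measurable_L\<close>)

lemma nm_powr: "nm f powr r = (LINT x|M. cmod (f x) powr r)"
  using exponent by (simp add: Lr_norm_def powr_powr Bochner_Integration.integral_nonneg)

lemma nm_le_iff:
  assumes "0 \<le> c"
  shows "nm f \<le> c \<longleftrightarrow> (LINT x|M. cmod (f x) powr r) \<le> c powr r"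
proof -
  have "nm f \<le> c \<longleftrightarrow> nm f powr r \<le> c powr r"
    using assms exponent by (smt (verit) nm_nonneg powr_less_mono2 powr_mono2)
  then show ?thesis by (simp add: nm_powr)
qed

lemma L_zero [simp]: "(\<lambda>_. 0) \<in> L"
  by (simp add: Lr_space_def)

lemma nm_zero [simp]: "nm (\<lambda>_. 0) = 0"
  by (simp add: Lr_norm_def)

text \<open>Membership matters: for a measurable function outside \<open>L\<close> the Bochner
  integral is 0, and so is its norm, although the function does not vanish.\<close>

lemma nm_eq_0_iff:
  assumes "f \<in> L"
  shows "nm f = 0 \<longleftrightarrow> (AE x in M. f x = 0)"
proof -
  have "nm f = 0 \<longleftrightarrow> (LINT x|M. cmod (f x) powr r) = 0"
    by (simp add: Lr_norm_def)
  also have "\<dots> \<longleftrightarrow> (AE x in M. cmod (f x) powr r = 0)"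
    using assms by (intro integral_nonneg_eq_0_iff_AE) (auto simp: Lr_space_def)
  finally show ?thesis by simp
qed

lemma L_scale: "f \<in> L \<Longrightarrow> (\<lambda>x. c * f x) \<in> L"
  by (auto simp: Lr_space_def norm_mult powr_mult)

lemma nm_scale: "nm (\<lambda>x. c * f x) = cmod c * nm f"
  using exponent
  by (simp add: Lr_norm_def norm_mult powr_mult powr_powr)

lemma L_add:
  assumes "f \<in> L" "g \<in> L"
  shows "(\<lambda>x. f x + g x) \<in> L"
proof -
  note [measurable] = assms[THEN measurable_L]
  have "integrable M (\<lambda>x. cmod (f x + g x) powr r)"
  proof (rule Bochner_Integration.integrable_bound)
    \<comment> \<open>The sum is twice the mean with weights 1/2, so convexity of the power gives an
      integrable majorant.\<close>
    show "integrable M (\<lambda>x. 2 powr r * (1 / 2 * cmod (f x) powr r + 1 / 2 * cmod (g x) powr r))"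
      using assms by (auto simp: Lr_space_def)
    show "AE x in M. norm (cmod (f x + g x) powr r)
        \<le> norm (2 powr r * (1 / 2 * cmod (f x) powr r + 1 / 2 * cmod (g x) powr r))"
    proof (rule AE_I2)
      fix x
      have "cmod (f x + g x) powr r \<le> (2 * (1 / 2 * cmod (f x) + 1 / 2 * cmod (g x))) powr r"
        using exponent norm_triangle_ineq[of "f x" "g x"] by (intro powr_mono2) auto
      also have "\<dots> \<le> 2 powr r * (1 / 2 * cmod (f x) powr r + 1 / 2 * cmod (g x) powr r)"
        unfolding powr_mult
        using powr_weighted_mean_le[OF exponent, of "cmod (f x)" "cmod (g x)" "1 / 2" "1 / 2"]
        by simp
      finally show "norm (cmod (f x + g x) powr r)
        \<le> norm (2 powr r * (1 / 2 * cmod (f x) powr r + 1 / 2 * cmod (g x) powr r))"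
        by simp
    qed
  qed simp
  then show ?thesis by (simp add: Lr_space_def)
qed

lemma L_diff: "f \<in> L \<Longrightarrow> g \<in> L \<Longrightarrow> (\<lambda>x. f x - g x) \<in> L"
  using L_add[of f "\<lambda>x. - 1 * g x"] L_scale[of g "- 1"] by simp

lemma L_uminus: "f \<in> L \<Longrightarrow> (\<lambda>x. - f x) \<in> L"
  using L_scale[of f "- 1"] by simp

lemma L_divide: "f \<in> L \<Longrightarrow> (\<lambda>x. f x / c) \<in> L"
  using L_scale[of f "inverse c"] by (simp add: field_simps)

lemma nm_uminus: "nm (\<lambda>x. - f x) = nm f"
  using nm_scale[of "- 1"] by simp

text \<open>Minkowski's inequality from convexity: with \<open>a\<close> and \<open>b\<close>
  slightly above the norms, \<open>f + g\<close> is \<open>a + b\<close> times the mean of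
  \<open>f / a\<close> and \<open>g / b\<close> with weights \<open>p\<close> and \<open>q\<close>,
  and both of these have norm at most 1.\<close>

lemma nm_add:
  assumes "f \<in> L" "g \<in> L"
  shows "nm (\<lambda>x. f x + g x) \<le> nm f + nm g"
proof (rule field_le_epsilon)
  fix e :: real assume "e > 0"
  \<comment> \<open>The margin \<open>e / 2\<close> keeps \<open>a\<close> and \<open>b\<close>
    positive even if a norm is 0, so that one can divide by them.\<close>
  define a where "a = nm f + e / 2"
  define b where "b = nm g + e / 2"
  have ab: "a > 0" "b > 0" "nm f \<le> a" "nm g \<le> b"
    using \<open>e > 0\<close> nm_nonneg[of f] nm_nonneg[of g] by (simp_all add: a_def b_def add_nonneg_pos)
  define p where "p = a / (a + b)"
  define q where "q = b / (a + b)"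
  have pq: "0 < p" "0 < q" "p + q = 1"
    using ab by (auto simp: p_def q_def simp flip: add_divide_distrib)
  have int: "integrable M (\<lambda>x. cmod (f x) powr r)" "integrable M (\<lambda>x. cmod (g x) powr r)"
    "integrable M (\<lambda>x. cmod (f x + g x) powr r)"
    using assms L_add[OF assms] by (auto simp: Lr_space_def)
  have "(LINT x|M. cmod (f x + g x) powr r) \<le>
    (LINT x|M. (a + b) powr r *
      (p * (cmod (f x) powr r / a powr r) + q * (cmod (g x) powr r / b powr r)))"
  proof (rule integral_mono)
    fix x
    have "cmod (f x + g x) powr r \<le> (cmod (f x) + cmod (g x)) powr r"
      using exponent norm_triangle_ineq[of "f x" "g x"] by (intro powr_mono2) auto
    also have "cmod (f x) + cmod (g x) = (a + b) * (p * (cmod (f x) / a) + q * (cmod (g x) / b))"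
      using ab by (simp add: p_def q_def distrib_left)
    also have "\<dots> powr r \<le> (a + b) powr r * (p * (cmod (f x) / a) powr r + q * (cmod (g x) / b) powr r)"
      unfolding powr_mult
      using powr_weighted_mean_le[OF exponent _ _ pq, of "cmod (f x) / a" "cmod (g x) / b"] ab
      by (intro mult_left_mono) auto
    finally show "cmod (f x + g x) powr r \<le> (a + b) powr r *
      (p * (cmod (f x) powr r / a powr r) + q * (cmod (g x) powr r / b powr r))"
      using ab by (simp add: powr_divide)
  qed (use int in auto)
  also have "\<dots> = (a + b) powr r * (p * ((LINT x|M. cmod (f x) powr r) / a powr r)
      + q * ((LINT x|M. cmod (g x) powr r) / b powr r))"
    using int by simp
  also have "\<dots> \<le> (a + b) powr r * (p * 1 + q * 1)"
    using ab pq nm_le_iff[of a f] nm_le_iff[of b g]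
    by (intro mult_left_mono add_mono) (auto simp: divide_le_eq)
  finally have "nm (\<lambda>x. f x + g x) \<le> a + b"
    using ab pq by (simp add: nm_le_iff)
  then show "nm (\<lambda>x. f x + g x) \<le> nm f + nm g + e"
    by (simp add: a_def b_def)
qed

lemma nm_diff_commute: "nm (\<lambda>x. f x - g x) = nm (\<lambda>x. g x - f x)"
  using nm_uminus[of "\<lambda>x. f x - g x"] by simp

lemma nm_triangle:
  assumes "f \<in> L" "g \<in> L" "h \<in> L"
  shows "nm (\<lambda>x. f x - h x) \<le> nm (\<lambda>x. f x - g x) + nm (\<lambda>x. g x - h x)"
  using nm_add[OF L_diff[OF assms(1,2)] L_diff[OF assms(2,3)]] by simp

lemma nm_le_nm_diff:
  assumes "f \<in> L" "g \<in> L"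
  shows "nm f \<le> nm (\<lambda>x. f x - g x) + nm g"
  using nm_add[OF L_diff[OF assms] assms(2)] by simp

section \<open>Convergence in \<open>L\<close>\<close>

lemma tendsD:
  assumes "tends u l A"
  shows "l \<in> L" "eventually (\<lambda>h. u h \<in> L) A" "((\<lambda>h. nm (\<lambda>x. u h x - l x)) \<longlongrightarrow> 0) A"
  using assms by (auto simp: Lr_tendsto_def)

lemma tends_by_bound:
  assumes "l \<in> L" "eventually (\<lambda>h. u h \<in> L) A"
    "eventually (\<lambda>h. nm (\<lambda>x. u h x - l x) \<le> b h) A" "(b \<longlongrightarrow> 0) A"
  shows "tends u l A"
  unfolding Lr_tendsto_def
proof (intro conjI assms)
  show "((\<lambda>h. nm (\<lambda>x. u h x - l x)) \<longlongrightarrow> 0) A"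
    by (rule tendsto_sandwich[OF _ assms(3) tendsto_const assms(4)]) simp
qed

lemma tends_const: "l \<in> L \<Longrightarrow> tends (\<lambda>_. l) l A"
  by (simp add: Lr_tendsto_def)

lemma tends_cong:
  assumes "tends u l A" "eventually (\<lambda>h. u' h \<in> L \<and> (AE x in M. u h x = u' h x)) A"
    "l' \<in> L" "AE x in M. l x = l' x"
  shows "tends u' l' A"
  unfolding Lr_tendsto_def
proof (intro conjI assms)
  note u = tendsD[OF assms(1)]
  show "eventually (\<lambda>h. u' h \<in> L) A"
    using assms(2) by eventually_elim simp
  have "eventually (\<lambda>h. nm (\<lambda>x. u h x - l x) = nm (\<lambda>x. u' h x - l' x)) A"
    using assms(2) u(2)
  proof eventually_elim
    case (elim h)
    then show ?case using u(1) assms(3,4) by (intro nm_cong_AE L_diff) auto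
  qed
  with u(3) show "((\<lambda>h. nm (\<lambda>x. u' h x - l' x)) \<longlongrightarrow> 0) A"
    by (rule Lim_transform_eventually)
qed

lemma tends_add:
  assumes "tends u k A" "tends v l A"
  shows "tends (\<lambda>h x. u h x + v h x) (\<lambda>x. k x + l x) A"
proof (rule tends_by_bound)
  note u = tendsD[OF assms(1)] and v = tendsD[OF assms(2)]
  show "(\<lambda>x. k x + l x) \<in> L" using u(1) v(1) by (rule L_add)
  show "eventually (\<lambda>h. (\<lambda>x. u h x + v h x) \<in> L) A"
    using u(2) v(2) by eventually_elim (rule L_add)
  show "eventually (\<lambda>h. nm (\<lambda>x. u h x + v h x - (k x + l x)) \<le>
      nm (\<lambda>x. u h x - k x) + nm (\<lambda>x. v h x - l x)) A"
    using u(2) v(2)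
  proof eventually_elim
    case (elim h)
    have eq: "(\<lambda>x. u h x + v h x - (k x + l x)) = (\<lambda>x. (u h x - k x) + (v h x - l x))"
      by auto
    show ?case unfolding eq
      using elim u(1) v(1) by (intro nm_add L_diff)
  qed
  show "((\<lambda>h. nm (\<lambda>x. u h x - k x) + nm (\<lambda>x. v h x - l x)) \<longlongrightarrow> 0) A"
    using tendsto_add[OF u(3) v(3)] by simp
qed

lemma tends_scale:
  assumes "(c \<longlongrightarrow> d) A" "tends u l A"
  shows "tends (\<lambda>h x. c h * u h x) (\<lambda>x. d * l x) A"
proof (rule tends_by_bound)
  note u = tendsD[OF assms(2)]
  show "(\<lambda>x. d * l x) \<in> L" using u(1) by (rule L_scale)
  show "eventually (\<lambda>h. (\<lambda>x. c h * u h x) \<in> L) A"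
    using u(2) by eventually_elim (rule L_scale)
  show "eventually (\<lambda>h. nm (\<lambda>x. c h * u h x - d * l x) \<le>
      cmod (c h) * nm (\<lambda>x. u h x - l x) + cmod (c h - d) * nm l) A"
    using u(2)
  proof eventually_elim
    case (elim h)
    have eq: "(\<lambda>x. c h * u h x - d * l x) = (\<lambda>x. c h * (u h x - l x) + (c h - d) * l x)"
      by (auto simp: algebra_simps)
    show ?case unfolding eq nm_scale[symmetric]
      using elim u(1) by (intro nm_add L_scale L_diff)
  qed
  have "((\<lambda>h. cmod (c h - d)) \<longlongrightarrow> 0) A"
    using assms(1) by (simp add: LIM_zero tendsto_norm_zero)
  then show "((\<lambda>h. cmod (c h) * nm (\<lambda>x. u h x - l x) + cmod (c h - d) * nm l) \<longlongrightarrow> 0) A"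
    using tendsto_add[OF tendsto_mult[OF tendsto_norm[OF assms(1)] u(3)]
      tendsto_mult_left_zero[of _ _ "nm l"]] by simp
qed

lemma tends_diff:
  assumes "tends u k A" "tends v l A"
  shows "tends (\<lambda>h x. u h x - v h x) (\<lambda>x. k x - l x) A"
  using tends_add[OF assms(1) tends_scale[OF tendsto_const[of "- 1"] assms(2)]] by simp

lemma tends_filter_le: "tends u l A \<Longrightarrow> B \<le> A \<Longrightarrow> tends u l B"
  unfolding Lr_tendsto_def by (auto intro: filter_leD tendsto_mono)

lemma tends_compose:
  assumes "tends u l A" "filterlim p A B"
  shows "tends (\<lambda>h. u (p h)) l B"
  using assms unfolding Lr_tendsto_def
  by (auto intro: eventually_compose_filterlim filterlim_compose)

lemma tends_nm:
  assumes "tends u l A"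
  shows "((\<lambda>h. nm (u h)) \<longlongrightarrow> nm l) A"
proof -
  note u = tendsD[OF assms]
  have "eventually (\<lambda>h. norm (nm (u h) - nm l) \<le> nm (\<lambda>x. u h x - l x)) A"
    using u(2)
  proof eventually_elim
    case (elim h)
    show ?case
      using nm_le_nm_diff[OF elim u(1)] nm_le_nm_diff[OF u(1) elim] nm_diff_commute[of l "u h"]
      by auto
  qed
  from Lim_null_comparison[OF this u(3)] show ?thesis
    by (simp add: LIM_zero_iff)
qed

text \<open>Reduces to the scalar mean value theorem: the distance \<open>N\<close> from
  \<open>y a\<close> is continuous, and by the reverse triangle inequality its difference quotients
  are dominated by the norms of those of \<open>y\<close>. Hence
  \<open>N b = N a = 0\<close>.\<close>

lemma constant_if_derivative_0:
  assumes "a \<le> b" and mem: "\<And>t. t \<in> {a..b} \<Longrightarrow> y t \<in> L"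
    and cont: "\<And>t. t \<in> {a..b} \<Longrightarrow> tends y (y t) (at t within {a..b})"
    and deriv: "\<And>t. a < t \<Longrightarrow> t < b \<Longrightarrow>
      tends (\<lambda>h x. (y (t + h) x - y t x) / of_real h) (\<lambda>_. 0) (at 0)"
  shows "AE x in M. y b x = y a x"
proof (cases "a = b")
  case False
  then have "a < b" using assms(1) by simp
  define N where "N t = nm (\<lambda>x. y t x - y a x)" for t
  have ya: "y a \<in> L" using mem \<open>a < b\<close> by simp
  have "N b = N a"
  proof (rule DERIV_isconst2[OF \<open>a < b\<close>])
    show "continuous_on {a..b} N"
      unfolding continuous_on_def N_def
      using tends_nm[OF tends_diff[OF cont tends_const[OF ya]]] by blast
    show "DERIV N t :> 0" if t: "a < t" "t < b" for t
      unfolding DERIV_def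
    proof (rule Lim_null_comparison)
      note d = tendsD[OF deriv[OF t]]
      show "((\<lambda>h. nm (\<lambda>x. (y (t + h) x - y t x) / of_real h)) \<longlongrightarrow> 0) (at 0)"
        using d(3) by simp
      have "eventually (\<lambda>h. h \<in> {a - t<..<b - t}) (at 0)"
        using t by (intro eventually_at_in_open') auto
      moreover have "eventually (\<lambda>h::real. h \<noteq> 0) (at 0)"
        by (simp add: eventually_at_filter)
      ultimately
      show "eventually (\<lambda>h. norm ((N (t + h) - N t) / h) \<le>
          nm (\<lambda>x. (y (t + h) x - y t x) / of_real h)) (at 0)"
      proof eventually_elim
        case (elim h)
        then have m: "y (t + h) \<in> L" "y t \<in> L" using t by (auto intro: mem)
        have "\<bar>N (t + h) - N t\<bar> \<le> nm (\<lambda>x. y (t + h) x - y t x)"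
          unfolding N_def
          using nm_triangle[OF m ya] nm_triangle[OF m(2,1) ya] nm_diff_commute[of "y t" "y (t + h)"]
          by linarith
        moreover have "nm (\<lambda>x. (y (t + h) x - y t x) / of_real h)
            = nm (\<lambda>x. y (t + h) x - y t x) / \<bar>h\<bar>"
          using nm_scale[of "inverse (of_real h)" "\<lambda>x. y (t + h) x - y t x"]
          by (simp add: divide_inverse norm_inverse mult.commute)
        ultimately show ?case
          by (simp add: divide_right_mono)
      qed
    qed
  qed (use \<open>a < b\<close> in auto)
  then have "nm (\<lambda>x. y b x - y a x) = 0"
    by (simp add: N_def)
  with mem[of b] ya \<open>a < b\<close> show ?thesis
    by (simp add: nm_eq_0_iff L_diff)
qed simp

end

section \<open>Evolution families\<close>

locale evolution = Lebesgue_space M r for M :: "'b measure" and r :: real +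
  fixes A :: "real \<Rightarrow> ('b \<Rightarrow> complex) \<Rightarrow> ('b \<Rightarrow> complex) \<Rightarrow> bool"
    and U :: "real \<Rightarrow> real \<Rightarrow> ('b \<Rightarrow> complex) \<Rightarrow> 'b \<Rightarrow> complex"
  assumes family: "evolution_family M r A U"
begin

lemmas family_unfolded = family[unfolded evolution_family_def]

lemma U_bound:
  obtains C where "C > 0"
    "\<And>s t f. 0 \<le> s \<Longrightarrow> s \<le> t \<Longrightarrow> t \<le> T \<Longrightarrow> f \<in> L \<Longrightarrow> nm (U s t f) \<le> C * nm f"
proof -
  obtain C where C: "\<forall>s t. \<forall>f\<in>L. 0 \<le> s \<and> s \<le> t \<and> t \<le> T \<longrightarrow>
        U s t f \<in> L \<and> nm (U s t f) \<le> C * nm f"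
    using family_unfolded[THEN conjunct1] by metis
  show thesis
  proof
    \<comment> \<open>The constant in the definition carries no sign; a positive one is made from
      it.\<close>
    show "\<bar>C\<bar> + 1 > 0" by simp
    fix s t f assume "0 \<le> s" "s \<le> t" "t \<le> T" "f \<in> L"
    then have "nm (U s t f) \<le> C * nm f" using C by blast
    also have "\<dots> \<le> (\<bar>C\<bar> + 1) * nm f" by (intro mult_right_mono) auto
    finally show "nm (U s t f) \<le> (\<bar>C\<bar> + 1) * nm f" .
  qed
qed

lemma U_L: "0 \<le> s \<Longrightarrow> s \<le> t \<Longrightarrow> f \<in> L \<Longrightarrow> U s t f \<in> L"
  using family_unfolded[THEN conjunct1, THEN spec[of _ t]] by auto

lemma U_linear:
  "0 \<le> s \<Longrightarrow> s \<le> t \<Longrightarrow> f \<in> L \<Longrightarrow> g \<in> L \<Longrightarrow>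
    AE x in M. U s t (\<lambda>x. a * f x + b * g x) x = a * U s t f x + b * U s t g x"
  using family_unfolded[THEN conjunct2, THEN conjunct1] by simp

lemma U_refl: "0 \<le> s \<Longrightarrow> f \<in> L \<Longrightarrow> AE x in M. U s s f x = f x"
  using family_unfolded[THEN conjunct2, THEN conjunct2, THEN conjunct1] by simp

lemma U_cocycle:
  "0 \<le> s \<Longrightarrow> s \<le> t \<Longrightarrow> t \<le> u \<Longrightarrow> f \<in> L \<Longrightarrow> AE x in M. U t u (U s t f) x = U s u f x"
  using family_unfolded[THEN conjunct2, THEN conjunct2, THEN conjunct2, THEN conjunct1] by simp

lemma U_forward:
  assumes "0 \<le> s" "s < t" "f \<in> L"
  obtains g where "A t (U s t f) g"
    "tends (\<lambda>h x. (U s (t + h) f x - U s t f x) / of_real h) g (at 0)"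
  using family_unfolded[THEN conjunct2, THEN conjunct2, THEN conjunct2, THEN conjunct2,
      THEN conjunct2, THEN conjunct1] assms by blast

lemma U_backward:
  "0 \<le> s \<Longrightarrow> s < t \<Longrightarrow> A s f g \<Longrightarrow>
    tends (\<lambda>h x. (U (s + h) t f x - U s t f x) / of_real h) (\<lambda>x. - U s t g x)
      (at 0 within {h. 0 \<le> s + h \<and> s + h \<le> t})"
  using family_unfolded[THEN conjunct2, THEN conjunct2, THEN conjunct2, THEN conjunct2,
      THEN conjunct2, THEN conjunct2] by simp

section \<open>Linearity, null functions and continuity of the operators\<close>

lemma U_diff:
  assumes "0 \<le> s" "s \<le> t" "f \<in> L" "g \<in> L"
  shows "AE x in M. U s t (\<lambda>x. f x - g x) x = U s t f x - U s t g x"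
  using U_linear[OF assms, of 1 "- 1"] by simp

lemma U_scale:
  assumes "0 \<le> s" "s \<le> t" "f \<in> L"
  shows "AE x in M. U s t (\<lambda>x. c * f x) x = c * U s t f x"
  using U_linear[OF assms assms(3), of c 0] by simp

lemma nm_U_diff:
  assumes "0 \<le> s" "s \<le> t" "f \<in> L" "g \<in> L"
  shows "nm (\<lambda>x. U s t f x - U s t g x) = nm (U s t (\<lambda>x. f x - g x))"
  using U_diff[OF assms] assms by (intro nm_cong_AE) (auto intro!: L_diff U_L)

text \<open>\<open>U s t\<close> acts on functions rather than classes; that it respects equality
  almost everywhere follows from linearity and the norm bound applied to
  \<open>f - g\<close>.\<close>

lemma U_cong_AE:
  assumes "0 \<le> s" "s \<le> t" "f \<in> L" "g \<in> L" "AE x in M. f x = g x"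
  shows "AE x in M. U s t f x = U s t g x"
proof -
  obtain C where C: "nm (U s t (\<lambda>x. f x - g x)) \<le> C * nm (\<lambda>x. f x - g x)"
    using U_bound[of t] assms by (metis L_diff order_refl)
  moreover have "nm (\<lambda>x. f x - g x) = 0"
    using assms by (simp add: nm_eq_0_iff L_diff)
  ultimately have "nm (\<lambda>x. U s t f x - U s t g x) = 0"
    using nm_U_diff[OF assms(1-4)] nm_nonneg[of "U s t (\<lambda>x. f x - g x)"] by simp
  with assms show ?thesis
    by (simp add: nm_eq_0_iff L_diff U_L)
qed

lemma U_tends:
  assumes f: "f \<in> L" and st: "0 \<le> s" "s \<le> t"
    and a: "(a \<longlongrightarrow> s) B" and b: "(b \<longlongrightarrow> t) B"
    and ab: "eventually (\<lambda>h. 0 \<le> a h \<and> a h \<le> b h) B"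
  shows "tends (\<lambda>h. U (a h) (b h) f) (U s t f) B"
  unfolding Lr_tendsto_def
proof (intro conjI U_L f st)
  show "eventually (\<lambda>h. U (a h) (b h) f \<in> L) B"
    using ab by eventually_elim (simp add: U_L f)
  define S where "S = {p. 0 \<le> fst p \<and> fst p \<le> (snd p :: real)}"
  define N where "N p = nm (\<lambda>x. U (fst p) (snd p) f x - U s t f x)" for p
  have "tends (\<lambda>p. U (fst p) (snd p) f) (U s t f) (at (s, t) within S)"
    unfolding S_def
    using family_unfolded[THEN conjunct2, THEN conjunct2, THEN conjunct2, THEN conjunct2,
        THEN conjunct1] f st by simp
  \<comment> \<open>The filter \<open>at (s, t) within S\<close> omits the point itself, but
    \<open>N (s, t) = 0\<close>; hence \<open>N\<close> is continuous there, and
    \<open>(a h, b h)\<close> may take the value \<open>(s, t)\<close>.\<close>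
  then have "(N \<longlongrightarrow> N (s, t)) (at (s, t) within S)"
    unfolding N_def by (auto dest: tendsD)
  then have "continuous (at (s, t) within S) N"
    by (simp add: continuous_within)
  from continuous_within_tendsto_compose[OF this, of "\<lambda>h. (a h, b h)" B]
  have "((\<lambda>h. N (a h, b h)) \<longlongrightarrow> N (s, t)) B"
    using ab a b by (auto simp: S_def intro: tendsto_Pair)
  then show "((\<lambda>h. nm (\<lambda>x. U (a h) (b h) f x - U s t f x)) \<longlongrightarrow> 0) B"
    by (simp add: N_def)
qed

text \<open>Split the difference into \<open>U (a h) (b h)\<close> applied to
  \<open>u h - f\<close>, controlled by the uniform bound, and the change of the operator on the
  fixed \<open>f\<close>, controlled by strong continuity.\<close>

lemma U_tends_arg:
  assumes u: "tends u f B" and st: "0 \<le> s" "s \<le> t"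
    and a: "(a \<longlongrightarrow> s) B" and b: "(b \<longlongrightarrow> t) B"
    and ab: "eventually (\<lambda>h. 0 \<le> a h \<and> a h \<le> b h) B"
  shows "tends (\<lambda>h. U (a h) (b h) (u h)) (U s t f) B"
proof -
  note u' = tendsD[OF u]
  \<comment> \<open>Eventually all times lie below the horizon \<open>t + 1\<close>, where one
    constant \<open>C\<close> serves.\<close>
  obtain C where C: "C > 0"
    "\<And>a b f. 0 \<le> a \<Longrightarrow> a \<le> b \<Longrightarrow> b \<le> t + 1 \<Longrightarrow> f \<in> L \<Longrightarrow> nm (U a b f) \<le> C * nm f"
    using U_bound[of "t + 1"] by metis
  have ev: "eventually (\<lambda>h. b h < t + 1) B"
    using b by (rule order_tendstoD) simp
  have "tends (\<lambda>h x. U (a h) (b h) (u h) x - U (a h) (b h) f x) (\<lambda>_. 0) B"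
  proof (rule tends_by_bound)
    show "eventually (\<lambda>h. (\<lambda>x. U (a h) (b h) (u h) x - U (a h) (b h) f x) \<in> L) B"
      using ab u'(2) by eventually_elim (auto intro: L_diff U_L u')
    show "eventually (\<lambda>h. nm (\<lambda>x. U (a h) (b h) (u h) x - U (a h) (b h) f x - 0)
        \<le> C * nm (\<lambda>x. u h x - f x)) B"
      using ab u'(2) ev
    proof eventually_elim
      case (elim h)
      then show ?case
        using C(2)[of "a h" "b h" "\<lambda>x. u h x - f x"] u'(1) by (simp add: nm_U_diff L_diff)
    qed
    show "((\<lambda>h. C * nm (\<lambda>x. u h x - f x)) \<longlongrightarrow> 0) B"
      using tendsto_mult[OF tendsto_const[of C] u'(3)] by simp
  qed simp
  from tends_add[OF this U_tends[OF u'(1) st a b ab]] show ?thesis by simp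
qed

text \<open>\<open>t \<mapsto> e\<^bsup>\<mu>t\<^esup> U\<^sub>t\<^sub>,\<^sub>b u\<^sub>t\<close> has derivative zero: the contributions \<open>- U\<^sub>t\<^sub>,\<^sub>b (A\<^sub>t u\<^sub>t)\<close>
  of the operator and \<open>U\<^sub>t\<^sub>,\<^sub>b (A\<^sub>t u\<^sub>t - \<mu> u\<^sub>t)\<close> of the argument leave only what the factor cancels.\<close>

lemma solution_unique:
  fixes u :: "real \<Rightarrow> 'b \<Rightarrow> complex" and \<mu> :: complex
  assumes ab: "0 \<le> a" "a \<le> b"
    and u_cont: "\<And>t. t \<in> {a..b} \<Longrightarrow> tends u (u t) (at t within {a..b})"
    and u_deriv: "\<And>t. a < t \<Longrightarrow> t < b \<Longrightarrow> \<exists>u' k. k \<in> L \<and> A t (u t) k \<and>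
      tends (\<lambda>h x. (u (t + h) x - u t x) / of_real h) u' (at 0) \<and>
      (AE x in M. u' x = k x - \<mu> * u t x)"
  shows "AE x in M. u b x = exp (- \<mu> * of_real (b - a)) * U a b (u a) x"
proof -
  have u_L: "u t \<in> L" if "t \<in> {a..b}" for t
    using u_cont[OF that] by (rule tendsD)
  define y where "y t x = exp (\<mu> * of_real t) * U t b (u t) x" for t x
  have y_L: "y t \<in> L" if "t \<in> {a..b}" for t
    unfolding y_def using that ab u_L by (intro L_scale U_L) auto
  have "AE x in M. y b x = y a x"
  proof (rule constant_if_derivative_0[OF ab(2) y_L])
    show "tends y (y t) (at t within {a..b})" if t: "t \<in> {a..b}" for t
      unfolding y_def
    proof (intro tends_scale U_tends_arg u_cont t)
      show "((\<lambda>t. exp (\<mu> * of_real t)) \<longlongrightarrow> exp (\<mu> * of_real t)) (at t within {a..b})"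
        by (intro tendsto_intros)
      show "eventually (\<lambda>t. 0 \<le> t \<and> t \<le> b) (at t within {a..b})"
        using ab by (auto simp: eventually_at_filter)
    qed (use t ab in \<open>auto intro: tendsto_intros\<close>)
    show "tends (\<lambda>h x. (y (t + h) x - y t x) / of_real h) (\<lambda>_. 0) (at 0)"
      if t: "a < t" "t < b" for t
    proof -
      define c where "c h = exp (\<mu> * of_real (t + h))" for h
      obtain u' k where k: "k \<in> L" "A t (u t) k"
        and u': "tends (\<lambda>h x. (u (t + h) x - u t x) / of_real h) u' (at 0)"
        and u'_eq: "AE x in M. u' x = k x - \<mu> * u t x"
        using u_deriv[OF t] by blast
      have tb: "0 \<le> t" "t \<le> b" "t \<in> {a..b}" using t ab by auto
      note mem = tendsD(1)[OF u'] k(1) u_L[OF tb(3)]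
      have ev: "eventually (\<lambda>h. h \<in> {a - t<..<b - t} \<and> h \<noteq> 0) (at 0)"
        using eventually_at_in_open[of "{a - t<..<b - t}" 0] t by simp
      have c: "(c \<longlongrightarrow> c 0) (at 0)"
        unfolding c_def by (intro tendsto_intros)
      have c': "((\<lambda>h. (c h - c 0) / of_real h) \<longlongrightarrow> \<mu> * c 0) (at 0)"
      proof -
        have "((\<lambda>z. exp (\<mu> * (of_real t + z))) has_field_derivative \<mu> * c 0) (at 0)"
          by (auto intro!: derivative_eq_intros simp: c_def)
        then have "((\<lambda>z. (exp (\<mu> * (of_real t + z)) - c 0) / z) \<longlongrightarrow> \<mu> * c 0) (at 0)"
          by (simp add: DERIV_def c_def)
        moreover have "filterlim complex_of_real (at 0) (at 0)"
          unfolding filterlim_at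
          by (auto simp: eventually_at_filter intro!: tendsto_eq_intros)
        ultimately show ?thesis
          using filterlim_compose by (fastforce simp: c_def)
      qed
      have lim1: "tends (\<lambda>h. U (t + h) b (\<lambda>x. (u (t + h) x - u t x) / of_real h)) (U t b u') (at 0)"
      proof (rule U_tends_arg[OF u' tb(1,2)])
        show "((\<lambda>h. t + h) \<longlongrightarrow> t) (at 0)" by (auto intro!: tendsto_eq_intros)
        show "eventually (\<lambda>h. 0 \<le> t + h \<and> t + h \<le> b) (at 0)"
          using ev by eventually_elim (use ab in auto)
      qed simp
      \<comment> \<open>Since \<open>0 < t < b\<close>, the constraint on \<open>h\<close> holds
        near 0, and the restricted limit of the backward equation is a full limit.\<close>
      have "at 0 within {h. 0 \<le> t + h \<and> t + h \<le> b} = at 0"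
      proof (rule at_within_nhd)
        show "0 \<in> {- t<..<b - t}" using t ab by auto
      qed (use t in auto)
      with U_backward[OF tb(1) t(2) k(2)]
      have lim2: "tends (\<lambda>h x. (U (t + h) b (u t) x - U t b (u t) x) / of_real h)
          (\<lambda>x. - U t b k x) (at 0)"
        by simp
      \<comment> \<open>Product rule for difference quotients. The three terms are the changes of
        the argument, of the operator and of the exponential factor.\<close>
      have lim: "tends
        (\<lambda>h x. (c h * U (t + h) b (\<lambda>x. (u (t + h) x - u t x) / of_real h) x
            + c h * ((U (t + h) b (u t) x - U t b (u t) x) / of_real h))
            + (c h - c 0) / of_real h * U t b (u t) x)
        (\<lambda>x. (c 0 * U t b u' x + c 0 * - U t b k x) + \<mu> * c 0 * U t b (u t) x) (at 0)"
        by (intro tends_add tends_scale[OF c] tends_scale[OF c'] lim1 lim2 tends_const U_L tb mem)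
      show ?thesis
      proof (rule tends_cong[OF lim])
        \<comment> \<open>Inserting \<open>u' = k - \<mu> * u t\<close> leaves
          \<open>- \<mu> * c 0 * U t b (u t)\<close> from the first two terms, which the derivative
          of the factor cancels.\<close>
        have "AE x in M. U t b u' x = 1 * U t b k x + (- \<mu>) * U t b (u t) x"
          using U_cong_AE[OF tb(1,2) mem(1) L_diff[OF mem(2) L_scale[OF mem(3)]] u'_eq]
            U_linear[OF tb(1,2) mem(2,3), of 1 "- \<mu>"]
          by eventually_elim simp
        then show "AE x in M. c 0 * U t b u' x + c 0 * - U t b k x + \<mu> * c 0 * U t b (u t) x = 0"
          by eventually_elim (simp only:, simp add: algebra_simps)
        show "eventually (\<lambda>h. (\<lambda>x. (y (t + h) x - y t x) / of_real h) \<in> L \<and>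
          (AE x in M. c h * U (t + h) b (\<lambda>x. (u (t + h) x - u t x) / of_real h) x
            + c h * ((U (t + h) b (u t) x - U t b (u t) x) / of_real h)
            + (c h - c 0) / of_real h * U t b (u t) x = (y (t + h) x - y t x) / of_real h)) (at 0)"
          using ev
        proof eventually_elim
          case (elim h)
          then have th: "0 \<le> t + h" "t + h \<le> b" "t + h \<in> {a..b}" using ab by auto
          have "AE x in M. U (t + h) b (\<lambda>x. (u (t + h) x - u t x) / of_real h) x
              = (U (t + h) b (u (t + h)) x - U (t + h) b (u t) x) / of_real h"
            using U_linear[OF th(1,2) u_L[OF th(3)] mem(3), of "inverse (of_real h)" "- inverse (of_real h)"]
            by (simp add: divide_inverse algebra_simps)
          then have "AE x in M. c h * U (t + h) b (\<lambda>x. (u (t + h) x - u t x) / of_real h) x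
            + c h * ((U (t + h) b (u t) x - U t b (u t) x) / of_real h)
            + (c h - c 0) / of_real h * U t b (u t) x = (y (t + h) x - y t x) / of_real h"
            by eventually_elim (simp only:, simp add: y_def c_def divide_inverse algebra_simps)
          with y_L[OF th(3)] y_L[OF tb(3)] show ?case
            by (auto intro: L_diff L_divide)
        qed
      qed simp
    qed
  qed
  moreover have "AE x in M. U b b (u b) x = u b x"
    using ab u_L by (intro U_refl) auto
  ultimately show ?thesis
  proof eventually_elim
    case (elim x)
    then have "exp (\<mu> * of_real b) * u b x = exp (\<mu> * of_real a) * U a b (u a) x"
      by (simp add: y_def)
    then show ?case
      by (simp add: exp_diff exp_minus field_simps right_diff_distrib)
  qed
qed

end

section \<open>Periodic evolution families\<close>

lemma (in Lebesgue_space) tends_if_derivative: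
  assumes "y t \<in> L" and d: "tends (\<lambda>h x. (y (t + h) x - y t x) / of_real h) d (at 0)"
  shows "tends y (y t) (at t)"
proof -
  have ne: "eventually (\<lambda>h::real. h \<noteq> 0) (at 0)"
    by (simp add: eventually_at_filter)
  have "((\<lambda>h. of_real h :: complex) \<longlongrightarrow> 0) (at 0)"
    by (auto intro!: tendsto_eq_intros)
  from tends_add[OF tends_scale[OF this d] tends_const[OF assms(1)]]
  have "tends (\<lambda>h. y (t + h)) (y t) (at 0)"
  proof (rule tends_cong)
    show "eventually (\<lambda>h. y (t + h) \<in> L \<and>
      (AE x in M. of_real h * ((y (t + h) x - y t x) / of_real h) + y t x = y (t + h) x)) (at 0)"
      using ne tendsD(2)[OF d]
    proof eventually_elim
      case (elim h)
      then show ?case using L_add[OF L_scale[OF elim(2), of "of_real h"] assms(1)] by simp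
    qed
  qed (use assms in auto)
  moreover have "filterlim (\<lambda>s. s - t) (at 0) (at t)"
    unfolding filterlim_at by (auto simp: eventually_at_filter intro!: tendsto_eq_intros)
  ultimately show ?thesis
    by (auto dest: tends_compose)
qed

text \<open>The generators enter only through \<open>t rmod \<tau>\<close>, hence are periodic in
  time. \<open>range_G\<close> supplies the membership of their values in \<open>L\<close> that
  \<open>solution_unique\<close> asks for.\<close>

locale periodic_evolution = evolution "leb_on X" r "\<lambda>t. G (t rmod \<tau>)" U
  for X :: "'a::euclidean_space set" and r :: real
    and G :: "real \<Rightarrow> ('a \<Rightarrow> complex) \<Rightarrow> ('a \<Rightarrow> complex) \<Rightarrow> bool"
    and \<tau> :: real and U +
  assumes period: "\<tau> > 0"
    and range_G: "G \<theta> f g \<Longrightarrow> g \<in> Lr_space (leb_on X) r"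
begin

abbreviation N :: "'a measure" where "N \<equiv> leb_on X"

lemma rmod_add_period [simp]: "(t + \<tau>) rmod \<tau> = t rmod \<tau>"
  using rmod_add[of t \<tau> \<tau>] by simp

lemma rmod_in_period [simp]: "t rmod \<tau> \<in> {0..<\<tau>}"
  using period by (simp add: rmod_nonneg rmod_less)

lemma rmod_nonneg' [simp]: "0 \<le> t rmod \<tau>"
  using period by (simp add: rmod_nonneg)

lemma rmod_less' [simp]: "t rmod \<tau> < \<tau>"
  using period by (simp add: rmod_less)

lemma rmod_in_period_eq [simp]: "0 \<le> t \<Longrightarrow> t < \<tau> \<Longrightarrow> t rmod \<tau> = t"
  by (rule rmod_idem) auto

lemma rmod_add_rmod [simp]: "(s rmod \<tau> + t) rmod \<tau> = (s + t) rmod \<tau>"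
  using rmod_add[of "s rmod \<tau>" \<tau> t] rmod_add[of s \<tau> t] by simp

lemma rmod_diff_rmod [simp]: "(s rmod \<tau> - t) rmod \<tau> = (s - t) rmod \<tau>"
  using rmod_add_rmod[of s "- t"] by simp

text \<open>As a function of \<open>t'\<close>, \<open>U (s + \<tau>) (t' + \<tau>) f\<close> solves
  the equation with the same operators as \<open>U s t' f\<close>, because \<open>rmod\<close>
  removes the shift. Both start from \<open>f\<close> at \<open>t' = s\<close>, and
  \<open>solution_unique\<close> applies with \<open>\<mu> = 0\<close>.\<close>

lemma U_periodic:
  assumes "0 \<le> s" "s \<le> t" "f \<in> L"
  shows "AE x in N. U (s + \<tau>) (t + \<tau>) f x = U s t f x"
proof -
  define u where "u t' = U (s + \<tau>) (t' + \<tau>) f" for t'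
  have "AE x in N. u t x = exp (- 0 * of_real (t - s)) * U s t (u s) x"
  proof (rule solution_unique[OF assms(1,2)])
    show "tends u (u t') (at t' within {s..t})" if "t' \<in> {s..t}" for t'
      unfolding u_def
    proof (rule U_tends[OF assms(3)])
      show "eventually (\<lambda>h. 0 \<le> s + \<tau> \<and> s + \<tau> \<le> h + \<tau>) (at t' within {s..t})"
        using assms(1) period by (auto simp: eventually_at_filter)
    qed (use that assms period in \<open>auto intro!: tendsto_intros\<close>)
    show "\<exists>u' k. k \<in> L \<and> G (t' rmod \<tau>) (u t') k \<and>
        tends (\<lambda>h x. (u (t' + h) x - u t' x) / of_real h) u' (at 0) \<and>
        (AE x in N. u' x = k x - 0 * u t' x)" if "s < t'" "t' < t" for t'
    proof -
      have *: "0 \<le> s + \<tau>" "s + \<tau> < t' + \<tau>"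
        using that assms period by auto
      obtain g where "G ((t' + \<tau>) rmod \<tau>) (u t') g"
        "tends (\<lambda>h x. (U (s + \<tau>) (t' + \<tau> + h) f x - u t' x) / of_real h) g (at 0)"
        unfolding u_def using U_forward[OF * assms(3)] by blast
      moreover from this have "G (t' rmod \<tau>) (u t') g" by simp
      ultimately show ?thesis
        by (intro exI[of _ g]) (auto simp: u_def add_ac dest: tendsD)
    qed
  qed
  moreover have "AE x in N. U s t (u s) x = U s t f x"
    using assms period U_refl[of "s + \<tau>" f]
    by (intro U_cong_AE) (auto simp: u_def intro!: U_L)
  ultimately show ?thesis
    by eventually_elim (simp add: u_def)
qed

lemma U_periodic_nat:
  assumes "0 \<le> s" "s \<le> t" "f \<in> L"
  shows "AE x in N. U (s + of_nat n * \<tau>) (t + of_nat n * \<tau>) f x = U s t f x"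
proof (induction n)
  case (Suc n)
  have "AE x in N. U (s + of_nat n * \<tau> + \<tau>) (t + of_nat n * \<tau> + \<tau>) f x
      = U (s + of_nat n * \<tau>) (t + of_nat n * \<tau>) f x"
    using assms period by (intro U_periodic) auto
  with Suc show ?case
    by eventually_elim (simp add: algebra_simps)
qed simp

lemma U_rmod:
  assumes "0 \<le> s" "0 \<le> t" "f \<in> L"
  shows "AE x in N. U (s rmod \<tau>) (s rmod \<tau> + t) f x = U s (s + t) f x"
proof -
  \<comment> \<open>The number of whole periods in \<open>s\<close>; removing them leads from
    \<open>s\<close> to \<open>s rmod \<tau>\<close>.\<close>
  define n where "n = nat \<lfloor>s / \<tau>\<rfloor>"
  have e1: "s rmod \<tau> + of_nat n * \<tau> = s"
    using assms period by (simp add: n_def rmod_def)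
  then have e2: "s rmod \<tau> + t + of_nat n * \<tau> = s + t" by simp
  have "AE x in N. U (s rmod \<tau> + of_nat n * \<tau>) (s rmod \<tau> + t + of_nat n * \<tau>) f x
      = U (s rmod \<tau>) (s rmod \<tau> + t) f x"
    using assms by (intro U_periodic_nat) auto
  then show ?thesis
    unfolding e1 e2 by eventually_elim simp
qed

text \<open>The flow relation alone yields the rest. For \<open>t = \<tau>\<close> it is the
  eigenvalue equation; and since every slice is carried to every other one, a single vanishing slice
  would make all slices vanish.\<close>

lemma eigenslicesI:
  assumes slices: "\<And>s. s \<in> {0..<\<tau>} \<Longrightarrow> (\<lambda>x. f (s, x)) \<in> L"
    and flow: "\<And>s t. s \<in> {0..<\<tau>} \<Longrightarrow> t \<ge> 0 \<Longrightarrow> AE x in N.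
      f ((s + t) rmod \<tau>, x) = exp (- \<mu> * of_real t) * U s (s + t) (\<lambda>y. f (s, y)) x"
  shows "eigenslices \<tau> X U \<mu> f"
  unfolding eigenslices_def
proof (intro conjI ballI allI impI flow)
  show "AE x in N. U s (s + \<tau>) (\<lambda>y. f (s, y)) x = exp (\<mu> * of_real \<tau>) * f (s, x)"
    if "s \<in> {0..<\<tau>}" for s
    using flow[OF that less_imp_le[OF period]]
  proof eventually_elim
    case (elim x)
    then have "f (s, x) = exp (- \<mu> * of_real \<tau>) * U s (s + \<tau>) (\<lambda>y. f (s, y)) x"
      using that by simp
    then show ?case
      by (simp add: exp_minus)
  qed
next
  fix s' assume "\<exists>s\<in>{0..<\<tau>}. \<not> (AE x in N. f (s, x) = 0)" and s': "s' \<in> {0..<\<tau>}"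
  then obtain s where s: "s \<in> {0..<\<tau>}" "\<not> (AE x in N. f (s, x) = 0)" by blast
  \<comment> \<open>The waiting time from \<open>s'\<close> until the circle next reaches
    \<open>s\<close>.\<close>
  define t where "t = (s - s') rmod \<tau>"
  have t: "0 \<le> t" "(s' + t) rmod \<tau> = s"
    using s rmod_add_rmod[of "s - s'" s'] by (simp_all add: t_def add.commute)
  show "\<not> (AE x in N. f (s', x) = 0)"
  proof
    assume 0: "AE x in N. f (s', x) = 0"
    have "AE x in N. U s' (s' + t) (\<lambda>y. f (s', y)) x = U s' (s' + t) (\<lambda>_. 0) x"
      using 0 s' t by (intro U_cong_AE slices) auto
    moreover have "AE x in N. U s' (s' + t) (\<lambda>_. 0) x = 0"
      using U_scale[of s' "s' + t" "\<lambda>_. 0" 0] s' t by simp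
    ultimately have "AE x in N. f (s, x) = 0"
      using flow[OF s' t(1)] by eventually_elim (simp add: t)
    with s show False by simp
  qed
qed auto

text \<open>Extended periodically to all real times, the slices \<open>u t\<close> satisfy
  \<open>u' = G u - \<mu> u\<close>, so \<open>solution_unique\<close> gives the flow
  relation.\<close>

lemma eigenslices_if_classical:
  assumes "classical_augmented_generator r \<tau> X G f (\<lambda>p. \<mu> * f p)"
  shows "eigenslices \<tau> X U \<mu> f"
proof -
  obtain f' where C1: "slices_C1 r \<tau> X f f'"
    and gen: "\<And>\<theta>. \<theta> \<in> {0..<\<tau>} \<Longrightarrow> \<exists>k. G \<theta> (\<lambda>x. f (\<theta>, x)) k \<and>
          (AE x in N. \<mu> * f (\<theta>, x) = - f' (\<theta>, x) + k x)"
    using assms unfolding classical_augmented_generator_def by blast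
  have slices: "(\<lambda>x. f (s, x)) \<in> L" if "s \<in> {0..<\<tau>}" for s
    using C1 that unfolding slices_C1_def by blast
  define u where "u t x = f (t rmod \<tau>, x)" for t x
  have deriv: "tends (\<lambda>h x. (u (t + h) x - u t x) / of_real h) (\<lambda>x. f' (t rmod \<tau>, x)) (at 0)" for t
    using C1 unfolding slices_C1_def u_def by blast
  have u_L: "u t \<in> L" for t
    unfolding u_def by (rule slices) simp
  show ?thesis
  proof (rule eigenslicesI[OF slices])
    fix s t :: real assume st: "s \<in> {0..<\<tau>}" "t \<ge> 0"
    have "AE x in N. u (s + t) x = exp (- \<mu> * of_real (s + t - s)) * U s (s + t) (u s) x"
    proof (rule solution_unique)
      show "tends u (u t') (at t' within {s..s + t})" for t'
        using tends_if_derivative[OF u_L deriv] at_le[OF subset_UNIV] by (rule tends_filter_le)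
      show "\<exists>u' k. k \<in> L \<and> G (t' rmod \<tau>) (u t') k \<and>
          tends (\<lambda>h x. (u (t' + h) x - u t' x) / of_real h) u' (at 0) \<and>
          (AE x in N. u' x = k x - \<mu> * u t' x)" for t'
      proof -
        obtain k where k: "G (t' rmod \<tau>) (u t') k"
            "AE x in N. \<mu> * u t' x = - f' (t' rmod \<tau>, x) + k x"
          using gen[of "t' rmod \<tau>"] unfolding u_def by auto
        from k(2) have "AE x in N. f' (t' rmod \<tau>, x) = k x - \<mu> * u t' x"
          by eventually_elim simp
        with k(1) deriv[of t'] range_G show ?thesis by blast
      qed
    qed (use st in auto)
    moreover have "u s = (\<lambda>x. f (s, x))"
      using st by (simp add: u_def fun_eq_iff)
    ultimately show "AE x in N. f ((s + t) rmod \<tau>, x) = exp (- \<mu> * of_real t) * U s (s + t) (\<lambda>y. f (s, y)) x"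
      by (simp add: u_def)
  qed
qed

end

section \<open>The augmented process\<close>

lemma AE_lborel_shift:
  fixes c :: real
  assumes "AE t in lborel. Q t"
  shows "AE t in lborel. Q (t + c)"
proof -
  obtain Z where Z: "Z \<in> null_sets lborel" "{t. \<not> Q t} \<subseteq> Z"
    using assms by (auto simp: eventually_ae_filter)
  show ?thesis
  proof (rule AE_I'[OF null_sets_translation[OF Z(1), of "- c"]])
    show "{t \<in> space lborel. \<not> Q (t + c)} \<subseteq> {t. t - - c \<in> Z}"
      using Z(2) by auto
  qed
qed

text \<open>No null set contains an interval \<open>(a, c)\<close>, so every right neighbourhood of
  \<open>a\<close> keeps some good times. Together with a limit from the right this upgrades
  statements from almost every time to every time.\<close>

lemma frequently_at_right_if_AE:
  fixes a b :: real
  assumes "a < b" and ae: "AE t in lborel. a < t \<and> t < b \<longrightarrow> Q t"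
  shows "frequently Q (at_right a)"
proof (rule ccontr)
  assume "\<not> frequently Q (at_right a)"
  then have "eventually (\<lambda>t. \<not> Q t) (at_right a)"
    by (simp add: frequently_def)
  then obtain c where c: "c > a" "\<And>t. a < t \<Longrightarrow> t < c \<Longrightarrow> \<not> Q t"
    by (auto simp: eventually_at_right_field)
  from ae have "AE t in lborel. t \<notin> {a<..<min b c}"
    by eventually_elim (use c in auto)
  then have "emeasure lborel {a<..<min b c} = 0"
    using AE_iff_null_sets[of "{a<..<min b c}" lborel] by (simp add: null_sets_def)
  with assms(1) c(1) show False
    by simp
qed

text \<open>\<open>E\<close> is not assumed measurable, so the argument runs through measurable
  majorants \<open>S m\<close> with integral at most \<open>1 / Suc m\<close>. Their infimum
  \<open>R\<close> has integral 0, hence vanishes almost everywhere and forces \<open>E\<close> to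
  vanish.\<close>

lemma AE_eq_0_if_nn_integral_small:
  fixes E :: "'b \<Rightarrow> real"
  assumes "\<And>s. 0 \<le> E s"
    and small: "\<And>\<delta>. \<delta> > 0 \<Longrightarrow> \<exists>S\<in>borel_measurable M. (AE s in M. ennreal (E s) \<le> S s) \<and>
      (\<integral>\<^sup>+s. S s \<partial>M) \<le> ennreal \<delta>"
  shows "AE s in M. E s = 0"
proof -
  have "\<exists>S. \<forall>m::nat. S m \<in> borel_measurable M \<and> (AE s in M. ennreal (E s) \<le> S m s) \<and>
      (\<integral>\<^sup>+s. S m s \<partial>M) \<le> ennreal (1 / Suc m)"
    using small[of "1 / Suc _"] by (intro choice) fastforce
  then obtain S where [measurable]: "\<And>m::nat. S m \<in> borel_measurable M"
    and S: "\<And>m. AE s in M. ennreal (E s) \<le> S m s" "\<And>m. (\<integral>\<^sup>+s. S m s \<partial>M) \<le> ennreal (1 / Suc m)"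
    by blast
  define R where "R s = (INF m. S m s)" for s
  have [measurable]: "R \<in> borel_measurable M"
    unfolding R_def by measurable
  have "(\<integral>\<^sup>+s. R s \<partial>M) \<le> ennreal (1 / Suc m)" for m
    using nn_integral_mono[of M R "S m"] S(2)[of m] unfolding R_def
    by (meson INF_lower UNIV_I order_trans)
  moreover have "(\<lambda>m. ennreal (1 / Suc m)) \<longlonglongrightarrow> ennreal 0"
    by (intro tendsto_ennrealI LIMSEQ_Suc lim_1_over_n)
  ultimately have "(\<integral>\<^sup>+s. R s \<partial>M) \<le> 0"
    by (intro LIMSEQ_le_const[of _ 0]) auto
  then have "AE s in M. R s = 0"
    by (simp add: nn_integral_0_iff_AE)
  moreover have "AE s in M. \<forall>m. ennreal (E s) \<le> S m s"
    using S(1) by (simp add: AE_all_countable)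
  ultimately show ?thesis
  proof eventually_elim
    case (elim s)
    then have "ennreal (E s) \<le> R s"
      unfolding R_def by (intro INF_greatest) simp
    with elim assms(1)[of s] show ?case by simp
  qed
qed

text \<open>Norms converge along the filter, so a limit of positive norm would eventually exclude
  null functions.\<close>

lemma (in Lebesgue_space) tends_frequently_0:
  assumes u: "tends u l A" and freq: "frequently (\<lambda>h. AE x in M. u h x = 0) A"
  shows "AE x in M. l x = 0"
proof -
  note u' = tendsD[OF u]
  have "nm l = 0"
  proof (rule ccontr)
    assume "nm l \<noteq> 0"
    then have "nm l > 0" by (simp add: less_le)
    from order_tendstoD(1)[OF tends_nm[OF u] this] u'(2)
    have "eventually (\<lambda>h. \<not> (AE x in M. u h x = 0)) A"
      by eventually_elim (metis less_irrefl nm_eq_0_iff)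
    with freq show False by (simp add: frequently_def)
  qed
  with u'(1) show ?thesis by (simp add: nm_eq_0_iff)
qed

locale augmented_evolution = periodic_evolution X r G \<tau> "transfer_op X q"
  for X :: "'a::euclidean_space set" and r :: real
    and G :: "real \<Rightarrow> ('a \<Rightarrow> complex) \<Rightarrow> ('a \<Rightarrow> complex) \<Rightarrow> bool"
    and \<tau> :: real and q :: "real \<Rightarrow> real \<Rightarrow> 'a \<Rightarrow> 'a \<Rightarrow> real" +
  assumes borel_X [measurable]: "X \<in> sets borel"
    and finite_X: "emeasure lborel X < \<infinity>"
    and q: "set_borel_measurable borel {(s, t, y, z). 0 \<le> s \<and> s < t \<and> y \<in> X \<and> z \<in> X}
       (\<lambda>(s, t, y, z). q s t y z)"
begin

abbreviation "P \<equiv> transfer_op X q"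
abbreviation I :: "real measure" where "I \<equiv> leb_on {0..<\<tau>}"
text \<open>Time 0 is left out: the transfer operator over time 0 is the identity and not an
  integral against \<open>q\<close>.\<close>

abbreviation J :: "real measure" where "J \<equiv> leb_on {0<..}"

sublocale N: finite_measure N
  by (rule finite_measureI) (use finite_X in \<open>simp add: emeasure_restrict_space\<close>)

sublocale I: finite_measure I
  by (rule finite_measureI) (use period in \<open>simp add: emeasure_restrict_space\<close>)

sublocale J: sigma_finite_measure J
  by (rule sigma_finite_measure_restrict_space) (auto intro: lborel.sigma_finite_measure_axioms)

sublocale IN: pair_sigma_finite I N ..

sublocale IJ: pair_sigma_finite I J ..

sublocale aug: Lebesgue_space "augmented_space \<tau> X" r
  by standard (rule exponent)

lemma measurable_id_N [measurable]: "(\<lambda>x. x) \<in> N \<rightarrow>\<^sub>M borel"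
  by (rule measurable_restrict_space1) simp

lemma measurable_id_I [measurable]: "(\<lambda>x. x) \<in> I \<rightarrow>\<^sub>M borel"
  by (rule measurable_restrict_space1) simp

lemma measurable_id_J [measurable]: "(\<lambda>x. x) \<in> J \<rightarrow>\<^sub>M borel"
  by (rule measurable_restrict_space1) simp

lemma measurable_rmod [measurable]: "(\<lambda>t. t rmod \<tau>) \<in> borel \<rightarrow>\<^sub>M I"
proof (rule measurable_restrict_space2)
  show "(\<lambda>t. t rmod \<tau>) \<in> borel \<rightarrow>\<^sub>M lborel"
    unfolding rmod_def by measurable
qed auto

lemma AE_I_iff: "(AE s in I. Q s) \<longleftrightarrow> (AE s in lborel. 0 \<le> s \<and> s < \<tau> \<longrightarrow> Q s)"
  by (simp add: AE_restrict_space_iff)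

lemma AE_J_iff: "(AE s in J. Q s) \<longleftrightarrow> (AE s in lborel. 0 < s \<longrightarrow> Q s)"
  by (simp add: AE_restrict_space_iff)

text \<open>Extended by 0 outside its domain, the density is a Borel function \<open>Q\<close> on
  the whole product, and the transfer operator becomes an integral depending on a parameter. The
  strict inequality \<open>a k < b k\<close> keeps to the branch of \<open>transfer_op\<close> given
  by the kernel.\<close>

lemma transfer_measurable:
  fixes K :: "'k measure"
  assumes [measurable]: "a \<in> borel_measurable K" "b \<in> borel_measurable K"
      "\<phi> \<in> borel_measurable (K \<Otimes>\<^sub>M N)"
    and ab: "\<And>k. k \<in> space K \<Longrightarrow> 0 \<le> a k \<and> a k < b k"
  shows "(\<lambda>(k, x). P (a k) (b k) (\<lambda>y. \<phi> (k, y)) x) \<in> borel_measurable (K \<Otimes>\<^sub>M N)"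
proof -
  define Q where "Q = (\<lambda>p. indicator {(s, t, y, z). 0 \<le> s \<and> s < t \<and> y \<in> X \<and> z \<in> X} p *\<^sub>R
       (case p of (s, t, y, z) \<Rightarrow> q s t y z))"
  have [measurable]: "Q \<in> borel_measurable borel"
    using q unfolding set_borel_measurable_def Q_def .
  have "(\<lambda>(p, y). (a (fst p), b (fst p), y, snd p)) \<in> (K \<Otimes>\<^sub>M N) \<Otimes>\<^sub>M N \<rightarrow>\<^sub>M borel"
    unfolding borel_prod[symmetric] by measurable
  then have [measurable]: "(\<lambda>(p, y). Q (a (fst p), b (fst p), y, snd p)) \<in> borel_measurable ((K \<Otimes>\<^sub>M N) \<Otimes>\<^sub>M N)"
    unfolding split_beta' by measurable
  have "(\<lambda>p. LINT y|N. of_real (Q (a (fst p), b (fst p), y, snd p)) * \<phi> (fst p, y))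
      \<in> borel_measurable (K \<Otimes>\<^sub>M N)"
    by measurable
  also have "?this \<longleftrightarrow> ?thesis"
  proof (rule measurable_cong)
    fix p assume "p \<in> space (K \<Otimes>\<^sub>M N)"
    then obtain k x where p: "p = (k, x)" "k \<in> space K" "x \<in> X"
      by (auto simp: space_pair_measure)
    have "P (a k) (b k) (\<lambda>y. \<phi> (k, y)) x = (LINT y|N. of_real (q (a k) (b k) y x) * \<phi> (k, y))"
      using ab[OF p(2)] by (simp add: transfer_op_def set_lebesgue_integral_def integral_restrict_space)
    also have "\<dots> = (LINT y|N. of_real (Q (a k, b k, y, x)) * \<phi> (k, y))"
      using ab[OF p(2)] p(3) by (intro Bochner_Integration.integral_cong) (auto simp: Q_def)
    finally show "(LINT y|N. of_real (Q (a (fst p), b (fst p), y, snd p)) * \<phi> (fst p, y)) =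
        (case p of (k, x) \<Rightarrow> P (a k) (b k) (\<lambda>y. \<phi> (k, y)) x)"
      by (simp add: p)
  qed
  finally show ?thesis .
qed

text \<open>The preimage of a null subset of \<open>[0, \<tau>)\<close> under the rotation is a
  union of countably many translates of it, one for each integer number of periods.\<close>

lemma AE_I_rmod:
  assumes "AE \<theta> in I. Q \<theta>"
  shows "AE t in lborel. Q ((t + a) rmod \<tau>)"
proof -
  have "AE t in lborel. \<forall>n::int. 0 \<le> t + (a - of_int n * \<tau>) \<and> t + (a - of_int n * \<tau>) < \<tau>
      \<longrightarrow> Q (t + (a - of_int n * \<tau>))"
    unfolding AE_all_countable by (intro allI AE_lborel_shift[OF assms[unfolded AE_I_iff]])
  then show ?thesis
  proof eventually_elim
    case (elim t)
    define n where "n = \<lfloor>(t + a) / \<tau>\<rfloor>"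
    have "(t + a) rmod \<tau> = t + (a - of_int n * \<tau>)"
      using period by (simp add: rmod_def n_def)
    then show ?case
      using elim[rule_format, of n] rmod_in_period[of "t + a"] by simp
  qed
qed

text \<open>Cut the shifted window \<open>[c, c + \<tau>)\<close> at \<open>\<tau>\<close> and move
  the overhang back by one period, under which \<open>\<psi>\<close> is invariant.\<close>

lemma nn_integral_I_rotate:
  assumes [measurable]: "\<phi> \<in> borel_measurable I"
  shows "(\<integral>\<^sup>+s. \<phi> ((s + a) rmod \<tau>) \<partial>I) = (\<integral>\<^sup>+s. \<phi> s \<partial>I)"
proof -
  define c where "c = a rmod \<tau>"
  have c: "0 \<le> c" "c < \<tau>" by (simp_all add: c_def)
  define \<psi> where "\<psi> t = \<phi> (t rmod \<tau>)" for t
  have [measurable]: "\<psi> \<in> borel_measurable borel"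
    unfolding \<psi>_def by measurable
  have \<psi>_add: "\<psi> (t + \<tau>) = \<psi> t" for t by (simp add: \<psi>_def)
  have eq: "(s + a) rmod \<tau> = (s + c) rmod \<tau>" for s
    using rmod_add_rmod[of a s] by (simp add: c_def add.commute)
  have "(\<integral>\<^sup>+s. \<phi> ((s + a) rmod \<tau>) \<partial>I) = (\<integral>\<^sup>+s. \<psi> (s + c) * indicator {0..<\<tau>} s \<partial>lborel)"
    by (simp add: nn_integral_restrict_space \<psi>_def eq)
  also have "\<dots> = (\<integral>\<^sup>+s. \<psi> (c + s) * indicator {c..<c + \<tau>} (c + s) \<partial>lborel)"
    by (intro nn_integral_cong) (auto split: split_indicator simp: add.commute)
  also have "\<dots> = (\<integral>\<^sup>+s. \<psi> s * indicator {c..<c + \<tau>} s \<partial>lborel)"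
    by (subst nn_integral_real_affine[of "\<lambda>s. \<psi> s * indicator {c..<c + \<tau>} s" 1 c]) auto
  also have "\<dots> = (\<integral>\<^sup>+s. \<psi> s * indicator {c..<\<tau>} s + \<psi> s * indicator {\<tau>..<\<tau> + c} s \<partial>lborel)"
    using c by (intro nn_integral_cong) (auto split: split_indicator)
  also have "\<dots> = (\<integral>\<^sup>+s. \<psi> s * indicator {c..<\<tau>} s \<partial>lborel) + (\<integral>\<^sup>+s. \<psi> s * indicator {\<tau>..<\<tau> + c} s \<partial>lborel)"
    by (rule nn_integral_add) auto
  also have "(\<integral>\<^sup>+s. \<psi> s * indicator {\<tau>..<\<tau> + c} s \<partial>lborel)
      = (\<integral>\<^sup>+s. \<psi> (\<tau> + s) * indicator {\<tau>..<\<tau> + c} (\<tau> + s) \<partial>lborel)"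
    by (subst nn_integral_real_affine[of "\<lambda>s. \<psi> s * indicator {\<tau>..<\<tau> + c} s" 1 \<tau>]) auto
  also have "\<dots> = (\<integral>\<^sup>+s. \<psi> s * indicator {0..<c} s \<partial>lborel)"
    by (intro nn_integral_cong) (auto split: split_indicator simp: \<psi>_add add.commute[of \<tau>])
  also have "(\<integral>\<^sup>+s. \<psi> s * indicator {c..<\<tau>} s \<partial>lborel) + (\<integral>\<^sup>+s. \<psi> s * indicator {0..<c} s \<partial>lborel)
      = (\<integral>\<^sup>+s. \<psi> s * indicator {c..<\<tau>} s + \<psi> s * indicator {0..<c} s \<partial>lborel)"
    by (rule nn_integral_add[symmetric]) auto
  also have "\<dots> = (\<integral>\<^sup>+s. \<phi> s * indicator {0..<\<tau>} s \<partial>lborel)"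
    using c by (intro nn_integral_cong) (auto split: split_indicator simp: \<psi>_def)
  also have "\<dots> = (\<integral>\<^sup>+s. \<phi> s \<partial>I)"
    by (simp add: nn_integral_restrict_space)
  finally show ?thesis .
qed

lemma AE_slice_L:
  assumes "F \<in> aug.L"
  shows "AE \<theta> in I. (\<lambda>x. F (\<theta>, x)) \<in> L"
proof -
  note [measurable] = aug.measurable_L[OF assms]
  have "AE \<theta> in I. integrable N (\<lambda>x. cmod (F (\<theta>, x)) powr r)"
    using assms by (intro IN.AE_integrable_fst') (simp add: Lr_space_def)
  with AE_space show ?thesis
    by eventually_elim (simp add: Lr_space_def)
qed

lemma slice_nm_measurable [measurable]:
  assumes [measurable]: "F \<in> borel_measurable (augmented_space \<tau> X)"
  shows "(\<lambda>\<theta>. nm (\<lambda>x. F (\<theta>, x))) \<in> borel_measurable I"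
  unfolding Lr_norm_def by measurable

text \<open>Hoelder's inequality on the circle, by way of \<open>y \<le> c + c\<^sup>1\<^sup>-\<^sup>r y\<^sup>r\<close>.\<close>

lemma nn_integral_slice_nm_le:
  assumes F: "F \<in> aug.L" and c: "aug.nm F \<le> c" "c > 0"
  shows "(\<integral>\<^sup>+\<theta>. ennreal (nm (\<lambda>x. F (\<theta>, x))) \<partial>I) \<le> ennreal ((\<tau> + 1) * c)"
proof -
  note [measurable] = aug.measurable_L[OF F]
  \<comment> \<open>For \<open>y > c\<close> compare \<open>y powr (1 - r)\<close> with
    \<open>c powr (1 - r)\<close>, the exponent being nonpositive.\<close>
  have le: "y \<le> c + c powr (1 - r) * y powr r" if "0 \<le> y" for y
  proof (cases "y \<le> c")
    case False
    with c have "y > 0" by simp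
    have "y = y powr (1 - r) * y powr r"
      using \<open>y > 0\<close> by (simp flip: powr_add)
    also have "\<dots> \<le> c powr (1 - r) * y powr r"
      using False c exponent by (intro mult_right_mono powr_mono2') auto
    finally show ?thesis using c by simp
  qed (simp add: add_increasing2)
  have int: "integrable (augmented_space \<tau> X) (\<lambda>p. cmod (F p) powr r)"
    using F by (simp add: Lr_space_def)
  let ?k = "\<lambda>\<theta>. c + c powr (1 - r) * (LINT x|N. cmod (F (\<theta>, x)) powr r)"
  have "(\<integral>\<^sup>+\<theta>. ennreal (nm (\<lambda>x. F (\<theta>, x))) \<partial>I) \<le> (\<integral>\<^sup>+\<theta>. ennreal (?k \<theta>) \<partial>I)"
    by (intro nn_integral_mono ennreal_leI) (simp add: le flip: nm_powr)
  also have "\<dots> = ennreal (LINT \<theta>|I. ?k \<theta>)"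
    using c IN.integrable_fst'[OF int]
    by (intro nn_integral_eq_integral) (auto intro!: add_nonneg_nonneg mult_nonneg_nonneg Bochner_Integration.integral_nonneg)
  \<comment> \<open>\<open>\<tau> * c\<close> is the constant integrated over the circle; the second
    summand is at most \<open>c powr (1 - r) * c powr r = c\<close>, whence the factor
    \<open>\<tau> + 1\<close>.\<close>
  also have "(LINT \<theta>|I. ?k \<theta>) = \<tau> * c + c powr (1 - r) * aug.nm F powr r"
    using IN.integrable_fst'[OF int] IN.integral_fst'[OF int] period
    by (simp add: aug.nm_powr measure_restrict_space)
  also have "\<dots> \<le> \<tau> * c + c powr (1 - r) * c powr r"
    using c exponent by (intro add_left_mono mult_left_mono powr_mono2) auto
  also have "c powr (1 - r) * c powr r = c"
    using c by (simp flip: powr_add)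
  finally show ?thesis
    by (simp add: algebra_simps ennreal_leI)
qed

section \<open>From the defect of one step to the flow for almost every starting time\<close>

lemma augmented_generator_derivative:
  assumes "augmented_generator r \<tau> X P f (\<lambda>p. \<mu> * f p)"
  shows "aug.tends (\<lambda>h p. (augmented_transfer \<tau> P h f p - exp (\<mu> * of_real h) * f p) / of_real h)
    (\<lambda>_. 0) (at_right 0)"
proof -
  have f: "f \<in> aug.L"
    and gen: "aug.tends (\<lambda>h p. (augmented_transfer \<tau> P h f p - f p) / of_real h) (\<lambda>p. \<mu> * f p) (at_right 0)"
    using assms by (auto simp: augmented_generator_def generates_def)
  \<comment> \<open>As \<open>(exp (\<mu> * h) - 1) / h\<close> tends to \<open>\<mu>\<close>,
    replacing \<open>f + h * \<mu> * f\<close> by the exact exponential changes only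
    \<open>o(h)\<close>; exponentials multiply neatly along successive steps.\<close>
  have "((\<lambda>z. exp (\<mu> * z)) has_field_derivative \<mu>) (at 0)"
    by (auto intro!: derivative_eq_intros)
  then have "((\<lambda>z. (exp (\<mu> * z) - 1) / z) \<longlongrightarrow> \<mu>) (at 0)"
    by (simp add: DERIV_def)
  moreover have "filterlim complex_of_real (at 0) (at_right 0)"
    unfolding filterlim_at
    by (auto simp: eventually_at_filter intro!: tendsto_eq_intros)
  ultimately have "((\<lambda>h. (exp (\<mu> * of_real h) - 1) / of_real h) \<longlongrightarrow> \<mu>) (at_right 0)"
    by (rule filterlim_compose)
  from aug.tends_diff[OF gen aug.tends_scale[OF this aug.tends_const[OF f]]]
  have "aug.tends (\<lambda>h p. (augmented_transfer \<tau> P h f p - f p) / of_real h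
      - (exp (\<mu> * of_real h) - 1) / of_real h * f p) (\<lambda>p. \<mu> * f p - \<mu> * f p) (at_right 0)" .
  moreover have "(\<lambda>h p. (augmented_transfer \<tau> P h f p - f p) / of_real h
      - (exp (\<mu> * of_real h) - 1) / of_real h * f p) =
    (\<lambda>h p. (augmented_transfer \<tau> P h f p - exp (\<mu> * of_real h) * f p) / of_real h)"
    by (simp add: divide_inverse algebra_simps)
  ultimately show ?thesis
    by simp
qed

text \<open>Only steps of the form \<open>t / Suc n\<close> are tried, so that a whole number of
  them fills \<open>t\<close> exactly; \<open>n\<close> defects of size \<open>\<delta> * h\<close>
  then total \<open>\<delta> * t\<close>.\<close>

lemma augmented_generator_step:
  assumes gen: "augmented_generator r \<tau> X P f (\<lambda>p. \<mu> * f p)" and "t > 0" "\<delta> > 0"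
  obtains n :: nat and h where "n > 0" "h > 0" "of_nat n * h = t"
    "(\<lambda>p. augmented_transfer \<tau> P h f p - exp (\<mu> * of_real h) * f p) \<in> aug.L"
    "aug.nm (\<lambda>p. augmented_transfer \<tau> P h f p - exp (\<mu> * of_real h) * f p) \<le> \<delta> * h"
proof -
  let ?D = "\<lambda>h p. augmented_transfer \<tau> P h f p - exp (\<mu> * of_real h) * f p"
  note d = aug.tendsD[OF augmented_generator_derivative[OF gen]]
  have "eventually (\<lambda>h. (\<lambda>p. ?D h p / of_real h) \<in> aug.L \<and> aug.nm (\<lambda>p. ?D h p / of_real h) < \<delta>) (at_right 0)"
    using d(2) order_tendstoD(2)[OF d(3) \<open>\<delta> > 0\<close>] by eventually_elim simp
  moreover have "filterlim (\<lambda>n. t / Suc n) (at_right 0) sequentially"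
    unfolding filterlim_at using \<open>t > 0\<close> LIMSEQ_Suc[OF lim_const_over_n[of t]]
    by (auto simp del: of_nat_Suc)
  ultimately have "eventually (\<lambda>n. (\<lambda>p. ?D (t / Suc n) p / of_real (t / Suc n)) \<in> aug.L \<and>
      aug.nm (\<lambda>p. ?D (t / Suc n) p / of_real (t / Suc n)) < \<delta>) sequentially"
    by (rule eventually_compose_filterlim)
  then obtain n where n: "(\<lambda>p. ?D (t / Suc n) p / of_real (t / Suc n)) \<in> aug.L"
      "aug.nm (\<lambda>p. ?D (t / Suc n) p / of_real (t / Suc n)) < \<delta>"
    by (auto simp: eventually_sequentially)
  define h where "h = t / Suc n"
  have h: "h > 0" using \<open>t > 0\<close> by (simp add: h_def)
  have eq: "?D h = (\<lambda>p. of_real h * (?D h p / of_real h))"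
    using h by auto
  show thesis
  proof
    show "?D h \<in> aug.L"
      by (subst eq, rule aug.L_scale) (use n(1) in \<open>simp only: h_def\<close>)
    have "aug.nm (?D h) = h * aug.nm (\<lambda>p. ?D h p / of_real h)"
      by (subst eq, subst aug.nm_scale) (use h in simp)
    also have "\<dots> \<le> h * \<delta>"
      using n(2) h by (intro mult_left_mono) (simp_all only: h_def)
    finally show "aug.nm (?D h) \<le> \<delta> * h" by (simp add: mult.commute)
    show "of_nat (Suc n) * h = t" by (simp add: h_def)
  qed (use h in auto)
qed

text \<open>Each local defect is transported to the final time by a single operator \<open>P\<close>, so the
  defects add up with one constant \<open>C\<close> instead of powers of it.\<close>

lemma orbit_defect_le:
  assumes C: "\<And>s t f. 0 \<le> s \<Longrightarrow> s \<le> t \<Longrightarrow> t \<le> T \<Longrightarrow> f \<in> L \<Longrightarrow> nm (P s t f) \<le> C * nm f" "C > 0"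
    and u: "\<And>k. k \<le> n \<Longrightarrow> u (s + of_nat k * h) \<in> L"
    and s: "0 \<le> s" "0 \<le> h" "s + of_nat n * h \<le> T"
  shows "nm (\<lambda>x. P s (s + of_nat n * h) (u s) x - exp (\<mu> * of_real (of_nat n * h)) * u (s + of_nat n * h) x)
    \<le> C * exp (cmod \<mu> * (of_nat n * h)) * (\<Sum>k<n. nm (\<lambda>x.
        P (s + of_nat k * h) (s + of_nat k * h + h) (u (s + of_nat k * h)) x
        - exp (\<mu> * of_real h) * u (s + of_nat k * h + h) x))"
proof -
  define t where "t = of_nat n * h"
  define a where "a k = s + of_nat k * h" for k
  have a: "0 \<le> a k" "a k \<le> s + t" "u (a k) \<in> L" if "k \<le> n" for k
    using that s u by (auto simp: a_def t_def intro!: mult_right_mono)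
  have a_Suc: "a (Suc k) = a k + h" for k by (simp add: a_def algebra_simps)
  define D where "D k = (\<lambda>x. P (a k) (a k + h) (u (a k)) x - exp (\<mu> * of_real h) * u (a k + h) x)" for k
  \<comment> \<open>Interpolates between the two sides: \<open>y k\<close> follows the eigenfunction
    for \<open>k\<close> steps and the operator for the rest, from
    \<open>y 0 = P s (s + t) (u s)\<close> to \<open>y n\<close>, which is
    \<open>exp (\<mu> * t) * u (s + t)\<close> almost everywhere. Neighbours differ by one
    transported defect.\<close>
  define y where "y k = (\<lambda>x. exp (\<mu> * of_real (of_nat k * h)) * P (a k) (s + t) (u (a k)) x)" for k
  have y_L: "y k \<in> L" if "k \<le> n" for k
    unfolding y_def using a[OF that] by (intro L_scale U_L)
  have step: "nm (\<lambda>x. y k x - y (Suc k) x) \<le> C * exp (cmod \<mu> * t) * nm (D k)" if "k < n" for k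
  proof -
    have k: "k \<le> n" "Suc k \<le> n" using that by auto
    note ak = a[OF k(1)] and ak' = a[OF k(2), unfolded a_Suc]
    have Pk: "P (a k) (a k + h) (u (a k)) \<in> L"
      using ak s by (intro U_L) auto
    have D_L: "D k \<in> L"
      unfolding D_def by (intro L_diff L_scale Pk ak')
    have "AE x in N. P (a k + h) (s + t) (P (a k) (a k + h) (u (a k))) x = P (a k) (s + t) (u (a k)) x"
      using ak ak' s by (intro U_cocycle) auto
    moreover have "AE x in N. P (a k + h) (s + t) (D k) x
        = 1 * P (a k + h) (s + t) (P (a k) (a k + h) (u (a k))) x
          + - exp (\<mu> * of_real h) * P (a k + h) (s + t) (u (a k + h)) x"
      unfolding D_def using U_linear[OF ak'(1,2) Pk ak'(3), of 1 "- exp (\<mu> * of_real h)"] by simp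
    ultimately have "AE x in N. y k x - y (Suc k) x
        = exp (\<mu> * of_real (of_nat k * h)) * P (a k + h) (s + t) (D k) x"
      by eventually_elim (simp only:, simp add: y_def a_Suc algebra_simps exp_add)
    then have "nm (\<lambda>x. y k x - y (Suc k) x)
        = nm (\<lambda>x. exp (\<mu> * of_real (of_nat k * h)) * P (a k + h) (s + t) (D k) x)"
      using k ak' D_L by (intro nm_cong_AE L_diff y_L L_scale U_L)
    also have "\<dots> = cmod (exp (\<mu> * of_real (of_nat k * h))) * nm (P (a k + h) (s + t) (D k))"
      by (rule nm_scale)
    also have "\<dots> \<le> exp (cmod \<mu> * t) * (C * nm (D k))"
    proof (rule mult_mono)
      have "cmod (exp (\<mu> * of_real (of_nat k * h))) \<le> exp (cmod (\<mu> * of_real (of_nat k * h)))"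
        by (rule norm_exp)
      also have "\<dots> \<le> exp (cmod \<mu> * t)"
        using k s by (auto simp: norm_mult t_def intro!: mult_left_mono mult_right_mono)
      finally show "cmod (exp (\<mu> * of_real (of_nat k * h))) \<le> exp (cmod \<mu> * t)" .
      show "nm (P (a k + h) (s + t) (D k)) \<le> C * nm (D k)"
        using ak' s D_L by (intro C(1)) (auto simp: t_def)
    qed auto
    finally show ?thesis by (simp add: mult_ac)
  qed
  have "nm (\<lambda>x. y 0 x - y m x) \<le> (\<Sum>k<m. nm (\<lambda>x. y k x - y (Suc k) x))" if "m \<le> n" for m
    using that
  proof (induction m)
    case (Suc m)
    have "nm (\<lambda>x. y 0 x - y (Suc m) x) \<le> nm (\<lambda>x. y 0 x - y m x) + nm (\<lambda>x. y m x - y (Suc m) x)"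
      using Suc.prems by (intro nm_triangle y_L) auto
    with Suc show ?case by simp
  qed simp
  from this[of n] have "nm (\<lambda>x. y 0 x - y n x) \<le> (\<Sum>k<n. nm (\<lambda>x. y k x - y (Suc k) x))" by simp
  also have "\<dots> \<le> (\<Sum>k<n. C * exp (cmod \<mu> * t) * nm (D k))"
    by (intro sum_mono step) simp
  also have "nm (\<lambda>x. y 0 x - y n x) = nm (\<lambda>x. P s (s + t) (u s) x - exp (\<mu> * of_real t) * u (s + t) x)"
  proof (rule nm_cong_AE)
    have an: "a n = s + t" "a 0 = s" by (simp_all add: a_def t_def)
    have "AE x in N. P (s + t) (s + t) (u (s + t)) x = u (s + t) x"
      using a[of n] by (intro U_refl) (auto simp: an)
    then show "AE x in N. y 0 x - y n x = P s (s + t) (u s) x - exp (\<mu> * of_real t) * u (s + t) x"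
      by eventually_elim (simp add: y_def an flip: t_def)
    show "(\<lambda>x. P s (s + t) (u s) x - exp (\<mu> * of_real t) * u (s + t) x) \<in> L"
      using a[of n] a[of 0] by (intro L_diff L_scale U_L) (auto simp: an)
  qed (intro L_diff y_L; simp)
  finally show ?thesis
    by (simp add: t_def D_def a_def sum_distrib_left)
qed

text \<open>The defect \<open>E\<close> after time \<open>t\<close> has a majorant \<open>S\<close>
  built from the \<open>n\<close> one-step defects along the orbit. Integrated over the circle, each
  of these contributes the same amount by rotation invariance, at most
  \<open>(\<tau> + 1) * \<delta> * h\<close>, so the total is proportional to
  \<open>\<delta> * t\<close> and arbitrarily small.\<close>

lemma augmented_eigenfunction_flow:
  assumes gen: "augmented_generator r \<tau> X P f (\<lambda>p. \<mu> * f p)" and "t > 0"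
  shows "AE s in I. AE x in N.
    P s (s + t) (\<lambda>y. f (s, y)) x - exp (\<mu> * of_real t) * f ((s + t) rmod \<tau>, x) = 0"
proof -
  have f: "f \<in> aug.L"
    using gen by (simp add: augmented_generator_def generates_def)
  define u where "u t = (\<lambda>x. f (t rmod \<tau>, x))" for t
  define E where "E s = nm (\<lambda>x. P s (s + t) (u s) x - exp (\<mu> * of_real t) * u (s + t) x)" for s
  \<comment> \<open>Orbits of length \<open>t\<close> that start in \<open>[0, \<tau>)\<close> end
    before \<open>\<tau> + t\<close>.\<close>
  obtain C where C: "C > 0"
    "\<And>a b g. 0 \<le> a \<Longrightarrow> a \<le> b \<Longrightarrow> b \<le> \<tau> + t \<Longrightarrow> g \<in> L \<Longrightarrow> nm (P a b g) \<le> C * nm g"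
    using U_bound[of "\<tau> + t"] by metis
  define K where "K = C * exp (cmod \<mu> * t)"
  have K: "K > 0" using C by (simp add: K_def)
  have shift_L: "AE s in I. u (s + a) \<in> L" for a
    unfolding u_def AE_I_iff using AE_I_rmod[OF AE_slice_L[OF f], of a] by eventually_elim simp
  have "AE s in I. E s = 0"
  proof (rule AE_eq_0_if_nn_integral_small)
    show "0 \<le> E s" for s by (simp add: E_def)
    fix \<delta>' :: real assume "\<delta>' > 0"
    \<comment> \<open>Chosen so that
      \<open>K * (\<tau> + 1) * t * \<delta> = \<delta>'\<close>.\<close>
    define \<delta> where "\<delta> = \<delta>' / (K * (\<tau> + 1) * t)"
    have "\<delta> > 0" using K period \<open>\<delta>' > 0\<close> \<open>t > 0\<close> by (simp add: \<delta>_def)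
    obtain n :: nat and h where n: "n > 0" "h > 0" "of_nat n * h = t"
      and D_L: "(\<lambda>p. augmented_transfer \<tau> P h f p - exp (\<mu> * of_real h) * f p) \<in> aug.L"
      and D_le: "aug.nm (\<lambda>p. augmented_transfer \<tau> P h f p - exp (\<mu> * of_real h) * f p) \<le> \<delta> * h"
      by (rule augmented_generator_step[OF gen \<open>t > 0\<close> \<open>\<delta> > 0\<close>])
    define D where "D p = augmented_transfer \<tau> P h f p - exp (\<mu> * of_real h) * f p" for p
    define d where "d \<theta> = nm (\<lambda>x. D (\<theta>, x))" for \<theta>
    have [measurable]: "D \<in> borel_measurable (augmented_space \<tau> X)"
      using D_L unfolding D_def by (rule aug.measurable_L)
    have [measurable]: "d \<in> borel_measurable I"
      unfolding d_def by measurable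
    \<comment> \<open>Defect \<open>k\<close> is read off at the end of its step, at time
      \<open>s + k * h + h\<close>, since the augmented semigroup pushes mass forward to that
      slice.\<close>
    define S where "S s = ennreal K * (\<Sum>k<n. ennreal (d ((s + (of_nat k * h + h)) rmod \<tau>)))" for s
    \<comment> \<open>The slice of \<open>D\<close> over \<open>(a + h) rmod \<tau>\<close> starts
      its transfer at \<open>a rmod \<tau>\<close>; periodicity of the operators moves the start
      back to \<open>a\<close>.\<close>
    have d_eq: "nm (\<lambda>x. P a (a + h) (u a) x - exp (\<mu> * of_real h) * u (a + h) x) = d ((a + h) rmod \<tau>)"
      if "a \<ge> 0" "u a \<in> L" "u (a + h) \<in> L" for a
      unfolding d_def
    proof (rule nm_cong_AE)
      have D_eq: "D ((a + h) rmod \<tau>, x)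
          = P (a rmod \<tau>) (a rmod \<tau> + h) (u a) x - exp (\<mu> * of_real h) * u (a + h) x" for x
        by (simp add: D_def augmented_transfer_def u_def Let_def)
      show "(\<lambda>x. P a (a + h) (u a) x - exp (\<mu> * of_real h) * u (a + h) x) \<in> L"
        using that n by (intro L_diff L_scale U_L) auto
      show "(\<lambda>x. D ((a + h) rmod \<tau>, x)) \<in> L"
        unfolding D_eq using that n by (intro L_diff L_scale U_L) auto
      show "AE x in N. P a (a + h) (u a) x - exp (\<mu> * of_real h) * u (a + h) x = D ((a + h) rmod \<tau>, x)"
        unfolding D_eq using U_rmod[OF that(1) less_imp_le[OF n(2)] that(2)] by eventually_elim simp
    qed
    have "AE s in I. \<forall>k. u (s + of_nat k * h) \<in> L"
      unfolding AE_all_countable using shift_L by blast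
    with AE_space have "AE s in I. ennreal (E s) \<le> S s"
    proof eventually_elim
      case (elim s)
      then have s: "0 \<le> s" "s < \<tau>" by auto
      have "E s \<le> K * (\<Sum>k<n. nm (\<lambda>x.
        P (s + of_nat k * h) (s + of_nat k * h + h) (u (s + of_nat k * h)) x
        - exp (\<mu> * of_real h) * u (s + of_nat k * h + h) x))"
        unfolding E_def K_def n(3)[symmetric]
        by (rule orbit_defect_le[OF C(2,1)]) (use s n elim in auto)
      also have "\<dots> = K * (\<Sum>k<n. d ((s + (of_nat k * h + h)) rmod \<tau>))"
      proof (intro arg_cong[where f = "\<lambda>y. K * y"] sum.cong refl)
        fix k
        have "u (s + of_nat k * h + h) \<in> L"
          using elim(2)[rule_format, of "Suc k"] by (simp add: algebra_simps)
        with d_eq[of "s + of_nat k * h"] s n elim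
        show "nm (\<lambda>x. P (s + of_nat k * h) (s + of_nat k * h + h) (u (s + of_nat k * h)) x
          - exp (\<mu> * of_real h) * u (s + of_nat k * h + h) x) = d ((s + (of_nat k * h + h)) rmod \<tau>)"
          by (simp add: add.assoc)
      qed
      finally have "ennreal (E s) \<le> ennreal (K * (\<Sum>k<n. d ((s + (of_nat k * h + h)) rmod \<tau>)))"
        by (rule ennreal_leI)
      also have "\<dots> = S s"
        using K by (simp add: S_def d_def ennreal_mult sum_nonneg sum_ennreal)
      finally show ?case .
    qed
    moreover have [measurable]: "S \<in> borel_measurable I"
      unfolding S_def by measurable
    moreover have "(\<integral>\<^sup>+s. S s \<partial>I) \<le> ennreal \<delta>'"
    proof -
      have "(\<integral>\<^sup>+s. S s \<partial>I) = ennreal K * (\<Sum>k<n. \<integral>\<^sup>+s. ennreal (d ((s + (of_nat k * h + h)) rmod \<tau>)) \<partial>I)"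
        unfolding S_def by (simp add: nn_integral_cmult nn_integral_sum)
      also have "\<dots> = ennreal K * (\<Sum>k<n. \<integral>\<^sup>+s. ennreal (d s) \<partial>I)"
        using nn_integral_I_rotate[of "\<lambda>s. ennreal (d s)"] by simp
      also have "\<dots> \<le> ennreal K * (\<Sum>k<n. ennreal ((\<tau> + 1) * (\<delta> * h)))"
        unfolding d_def using nn_integral_slice_nm_le[OF D_L D_le] \<open>\<delta> > 0\<close> n
        by (intro mult_left_mono sum_mono) (auto simp: D_def)
      also have "\<dots> = ennreal (K * (\<Sum>k<n. (\<tau> + 1) * (\<delta> * h)))"
        using K period \<open>\<delta> > 0\<close> n by (subst sum_ennreal) (auto simp: ennreal_mult sum_nonneg)
      also have "K * (\<Sum>k<n. (\<tau> + 1) * (\<delta> * h)) = K * (\<tau> + 1) * (of_nat n * h) * \<delta>"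
        by simp
      also have "\<dots> = \<delta>'"
        unfolding n(3) using K period \<open>t > 0\<close> by (simp add: \<delta>_def)
      finally show ?thesis .
    qed
    ultimately show "\<exists>S\<in>borel_measurable I. (AE s in I. ennreal (E s) \<le> S s) \<and> (\<integral>\<^sup>+s. S s \<partial>I) \<le> ennreal \<delta>'"
      by blast
  qed
  with shift_L[of 0] shift_L[of t] AE_space show ?thesis
  proof eventually_elim
    case (elim s)
    then have s: "0 \<le> s" "s < \<tau>" by auto
    have "(\<lambda>x. P s (s + t) (u s) x - exp (\<mu> * of_real t) * u (s + t) x) \<in> L"
      using elim s \<open>t > 0\<close> by (intro L_diff L_scale U_L) auto
    with elim s show ?case
      by (simp add: nm_eq_0_iff E_def) (simp add: u_def)
  qed
qed

section \<open>Versions with continuous slices\<close>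

lemma eigenslices_if_generator:
  assumes gen: "augmented_generator r \<tau> X P f (\<lambda>p. \<mu> * f p)"
    and g: "continuous_version r \<tau> X f g"
  shows "eigenslices \<tau> X P \<mu> g"
proof -
  have f: "f \<in> aug.L"
    using gen by (simp add: augmented_generator_def generates_def)
  define w where "w t = (\<lambda>x. g (t rmod \<tau>, x))" for t
  have cont: "tends w (w t) (at t)" for t
    using g unfolding continuous_version_def slices_continuous_def w_def by blast
  note w_L = tendsD(1)[OF cont]
  have slices: "(\<lambda>x. g (s, x)) = w s" if "s \<in> {0..<\<tau>}" for s
    using that by (simp add: w_def)
  have "AE s in I. AE x in N. g (s, x) = f (s, x)"
    using g IN.AE_pair[of "\<lambda>p. g p = f p"] unfolding continuous_version_def by simp
  from AE_I_rmod[OF this] have w_eq: "AE s in lborel. AE x in N. w (s + a) x = f ((s + a) rmod \<tau>, x)" for a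
    unfolding w_def .
  show ?thesis
  proof (rule eigenslicesI)
    show "(\<lambda>x. g (s, x)) \<in> L" if "s \<in> {0..<\<tau>}" for s
      using w_L slices[OF that] by simp
    fix s t :: real assume s: "s \<in> {0..<\<tau>}" and "t \<ge> 0"
    show "AE x in N. g ((s + t) rmod \<tau>, x) = exp (- \<mu> * of_real t) * P s (s + t) (\<lambda>y. g (s, y)) x"
    proof (cases "t = 0")
      case True
      with s show ?thesis by (simp add: transfer_op_def)
    next
      case False
      with \<open>t \<ge> 0\<close> have t: "t > 0" by simp
      \<comment> \<open>The defect vanishes for almost every \<open>a\<close> in
        \<open>(s, \<tau>)\<close>, where \<open>w\<close> agrees with the slices of
        \<open>f\<close> at both ends of the orbit piece, and it is continuous from the right at
        \<open>s\<close>; so it vanishes at \<open>s\<close> itself.\<close>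
      define e where "e s = (\<lambda>x. P s (s + t) (w s) x - exp (\<mu> * of_real t) * w (s + t) x)" for s
      have "AE a in lborel. s < a \<and> a < \<tau> \<longrightarrow> (AE x in N. e a x = 0)"
        using augmented_eigenfunction_flow[OF gen t, unfolded AE_I_iff] w_eq[of 0] w_eq[of t]
          AE_slice_L[OF f, unfolded AE_I_iff]
      proof eventually_elim
        case (elim a)
        show ?case
        proof
          assume "s < a \<and> a < \<tau>"
          then have a: "0 \<le> a" "a < \<tau>" using s by auto
          have "AE x in N. P a (a + t) (w a) x = P a (a + t) (\<lambda>x. f (a, x)) x"
            using elim a t w_L by (intro U_cong_AE) auto
          moreover have "AE x in N. P a (a + t) (\<lambda>x. f (a, x)) x
              - exp (\<mu> * of_real t) * f ((a + t) rmod \<tau>, x) = 0"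
            using elim a by blast
          ultimately show "AE x in N. e a x = 0"
            using elim(3) by eventually_elim (simp add: e_def)
        qed
      qed
      then have "frequently (\<lambda>a. AE x in N. e a x = 0) (at_right s)"
        using s by (intro frequently_at_right_if_AE[where b = \<tau>]) auto
      moreover have "tends e (e s) (at_right s)"
        unfolding e_def
      proof (intro tends_diff tends_scale[OF tendsto_const] U_tends_arg)
        show "tends w (w s) (at_right s)"
          using cont by (rule tends_filter_le) (rule at_le, simp)
        have "filterlim (\<lambda>a. a + t) (at (s + t)) (at_right s)"
          unfolding filterlim_at by (auto simp: eventually_at_filter intro!: tendsto_eq_intros)
        with cont show "tends (\<lambda>a. w (a + t)) (w (s + t)) (at_right s)"
          by (rule tends_compose)
        show "eventually (\<lambda>a. 0 \<le> a \<and> a \<le> a + t) (at_right s)"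
          using s t by (auto simp: eventually_at_filter)
      qed (use s t in \<open>auto intro!: tendsto_intros\<close>)
      ultimately have "AE x in N. e s x = 0"
        by (rule tends_frequently_0[rotated])
      then show ?thesis
        unfolding slices[OF s]
      proof eventually_elim
        case (elim x)
        then have "P s (s + t) (w s) x = exp (\<mu> * of_real t) * w (s + t) x"
          by (simp add: e_def)
        then show ?case by (simp add: w_def exp_minus)
      qed
    qed
  qed
qed

text \<open>Besides a good starting time \<open>s\<close>, the proof needs that the continuous curve
  \<open>y\<close> issuing from it is periodic at all positive times; then one period of it closes
  up on the circle without a jump.\<close>

lemma continuous_version_exists:
  assumes gen: "augmented_generator r \<tau> X P f (\<lambda>p. \<mu> * f p)"
  shows "\<exists>g. continuous_version r \<tau> X f g"
proof -
  have f: "f \<in> aug.L"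
    using gen by (simp add: augmented_generator_def generates_def)
  note [measurable] = aug.measurable_L[OF f]
  define H where "H = (\<lambda>(p, x). P (fst p) (fst p + snd p) (\<lambda>y. f (fst p, y)) x
      - exp (\<mu> * of_real (snd p)) * f ((fst p + snd p) rmod \<tau>, x))"
  have [measurable]: "(\<lambda>(p, x). P (fst p) (fst p + snd p) (\<lambda>y. f (fst p, y)) x)
      \<in> borel_measurable ((I \<Otimes>\<^sub>M J) \<Otimes>\<^sub>M N)"
    using transfer_measurable[of fst "I \<Otimes>\<^sub>M J" "\<lambda>p. fst p + snd p" "\<lambda>(p, y). f (fst p, y)"]
    by (auto simp: space_pair_measure)
  have [measurable]: "H \<in> borel_measurable ((I \<Otimes>\<^sub>M J) \<Otimes>\<^sub>M N)"
    unfolding H_def split_beta' by measurable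
  define Q where "Q s t \<longleftrightarrow> (AE x in N. P s (s + t) (\<lambda>y. f (s, y)) x
      - exp (\<mu> * of_real t) * f ((s + t) rmod \<tau>, x) = 0)" for s t
  \<comment> \<open>Exchanging the two quantifiers requires a measurable set of good pairs
    \<open>(s, t)\<close>, obtained as the zero set of the integral of \<open>cmod H\<close> over
    \<open>N\<close>.\<close>
  have "{p \<in> space (I \<Otimes>\<^sub>M J). Q (fst p) (snd p)}
      = {p \<in> space (I \<Otimes>\<^sub>M J). (\<integral>\<^sup>+x. ennreal (cmod (H (p, x))) \<partial>N) = 0}"
  proof (rule Collect_cong, rule conj_cong[OF refl])
    fix p assume p: "p \<in> space (I \<Otimes>\<^sub>M J)"
    have "(\<lambda>x. H (p, x)) \<in> borel_measurable N"
      using p by measurable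
    then show "Q (fst p) (snd p) \<longleftrightarrow> (\<integral>\<^sup>+x. ennreal (cmod (H (p, x))) \<partial>N) = 0"
      by (subst nn_integral_0_iff_AE) (auto simp: Q_def H_def)
  qed
  also have "\<dots> \<in> sets (I \<Otimes>\<^sub>M J)"
    by measurable
  finally have "(AE s in I. AE t in J. Q s t) \<longleftrightarrow> (AE t in J. AE s in I. Q s t)"
    by (rule IJ.AE_commute)
  moreover have "AE t in J. AE s in I. Q s t"
    unfolding Q_def AE_J_iff using augmented_eigenfunction_flow[OF gen] by simp
  ultimately have "AE s in I. AE t in J. Q s t" by simp
  with AE_slice_L[OF f] AE_space
  have "AE s in I. s \<in> {0..<\<tau>} \<and> (\<lambda>x. f (s, x)) \<in> L \<and> (AE t in J. Q s t)"
    by eventually_elim simp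
  \<comment> \<open>The circle has positive measure, so a property of almost every \<open>s\<close>
    holds for some \<open>s\<close>.\<close>
  moreover have "ae_filter I \<noteq> bot"
    using period by (simp add: ae_filter_eq_bot_iff emeasure_restrict_space)
  ultimately have "\<exists>s. s \<in> {0..<\<tau>} \<and> (\<lambda>x. f (s, x)) \<in> L \<and> (AE t in J. Q s t)"
    by (rule eventually_happens'[rotated])
  then obtain s where s: "0 \<le> s" "s < \<tau>" and fs: "(\<lambda>x. f (s, x)) \<in> L"
    and Q: "AE t in lborel. 0 < t \<longrightarrow> Q s t"
    by (auto simp: AE_J_iff)

  define y where "y t = (\<lambda>x. exp (- \<mu> * of_real t) * P s (s + t) (\<lambda>x. f (s, x)) x)" for t
  have y_cont: "tends y (y t) (at t)" if "t > 0" for t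
    unfolding y_def
  proof (intro tends_scale U_tends fs)
    show "eventually (\<lambda>t. 0 \<le> s \<and> s \<le> s + t) (at t)"
      using s eventually_at_in_open'[of "{0<..}" t] that by (auto elim: eventually_mono)
  qed (use s that in \<open>auto intro!: tendsto_intros\<close>)
  note y_L = tendsD(1)[OF y_cont]
  have y_eq: "AE t in lborel. 0 < t \<longrightarrow> (AE x in N. y t x = f ((s + t) rmod \<tau>, x))"
    using Q
  proof eventually_elim
    case (elim t)
    show ?case
    proof
      assume "0 < t"
      with elim have "Q s t" by simp
      then show "AE x in N. y t x = f ((s + t) rmod \<tau>, x)"
        unfolding Q_def by eventually_elim (simp add: y_def exp_minus)
    qed
  qed
  \<comment> \<open>Both sides agree with the same slice of \<open>f\<close> at almost every time;
    approaching \<open>t\<close> from the right through such times gives equality at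
    \<open>t\<close>.\<close>
  have y_periodic: "AE x in N. y (t + \<tau>) x = y t x" if t: "t > 0" for t
  proof -
    have "AE a in lborel. t < a \<and> a < t + 1 \<longrightarrow> (AE x in N. y (a + \<tau>) x - y a x = 0)"
      using y_eq AE_lborel_shift[OF y_eq, of \<tau>]
    proof eventually_elim
      case (elim a)
      show ?case
      proof
        assume "t < a \<and> a < t + 1"
        then have "AE x in N. y (a + \<tau>) x = f ((s + a + \<tau>) rmod \<tau>, x)"
            "AE x in N. y a x = f ((s + a) rmod \<tau>, x)"
          using elim t period by (auto simp: add.assoc)
        then show "AE x in N. y (a + \<tau>) x - y a x = 0"
          by eventually_elim simp
      qed
    qed
    then have "frequently (\<lambda>a. AE x in N. y (a + \<tau>) x - y a x = 0) (at_right t)"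
      by (rule frequently_at_right_if_AE[rotated]) simp
    moreover have "tends (\<lambda>a x. y (a + \<tau>) x - y a x) (\<lambda>x. y (t + \<tau>) x - y t x) (at_right t)"
    proof (rule tends_diff)
      have "filterlim (\<lambda>a. a + \<tau>) (at (t + \<tau>)) (at_right t)"
        unfolding filterlim_at by (auto simp: eventually_at_filter intro!: tendsto_eq_intros)
      then show "tends (\<lambda>a. y (a + \<tau>)) (y (t + \<tau>)) (at_right t)"
        by (rule tends_compose[OF y_cont, rotated]) (use t period in simp)
      show "tends y (y t) (at_right t)"
        using y_cont[OF t] by (rule tends_filter_le) (rule at_le, simp)
    qed
    ultimately have "AE x in N. y (t + \<tau>) x - y t x = 0"
      by (rule tends_frequently_0[rotated])
    then show ?thesis by eventually_elim simp
  qed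
  have y_periodic_nat: "AE x in N. y (t + of_nat n * \<tau>) x = y t x" if t: "t > 0" for t n
  proof (induction n)
    case (Suc n)
    have "AE x in N. y (t + of_nat n * \<tau> + \<tau>) x = y (t + of_nat n * \<tau>) x"
      using t period by (intro y_periodic add_pos_nonneg) auto
    with Suc show ?case
      by eventually_elim (simp add: algebra_simps)
  qed simp

  \<comment> \<open>The added \<open>\<tau>\<close> keeps the elapsed time
    \<open>\<theta> + \<tau> - s\<close> positive, because \<open>s < \<tau>\<close>;
    \<open>y_cont\<close> holds at positive times.\<close>
  define g where "g = (\<lambda>(\<theta>, x). y (\<theta> + \<tau> - s) x)"
  have g_slice: "AE x in N. y (t - s) x = g (t rmod \<tau>, x)" if t: "\<tau> \<le> t" for t
  proof -
    \<comment> \<open>One period is subtracted because \<open>g\<close> already contains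
      one.\<close>
    define n where "n = nat (\<lfloor>t / \<tau>\<rfloor> - 1)"
    have "1 \<le> t / \<tau>"
      using t period by simp
    then have "1 \<le> \<lfloor>t / \<tau>\<rfloor>" by linarith
    then have eq: "t - s = t rmod \<tau> + \<tau> - s + of_nat n * \<tau>"
      using period by (simp add: rmod_def n_def algebra_simps)
    have "t rmod \<tau> + \<tau> - s > 0"
      using s rmod_nonneg'[of t] by linarith
    from y_periodic_nat[OF this, of n] show ?thesis
      unfolding eq by (simp add: g_def)
  qed
  have g_L: "(\<lambda>x. g (t rmod \<tau>, x)) \<in> L" for t
    using y_L[of "t rmod \<tau> + \<tau> - s"] s rmod_nonneg'[of t] by (simp add: g_def)
  have "(\<lambda>(\<theta>, x). P s (\<theta> + \<tau>) (\<lambda>y. f (s, y)) x) \<in> borel_measurable (augmented_space \<tau> X)"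
  proof -
    have [measurable]: "(\<lambda>x. f (s, x)) \<in> borel_measurable N"
      using s by (intro measurable_compose[OF measurable_Pair1' aug.measurable_L[OF f]]) simp
    show ?thesis
      using transfer_measurable[of "\<lambda>_. s" I "\<lambda>\<theta>. \<theta> + \<tau>" "\<lambda>(\<theta>, y). f (s, y)"] s by auto
  qed
  then have [measurable]: "g \<in> borel_measurable (augmented_space \<tau> X)"
    unfolding g_def y_def split_beta' by simp
  have "AE \<theta> in I. AE x in N. g (\<theta>, x) = f (\<theta>, x)"
    unfolding AE_I_iff using AE_lborel_shift[OF y_eq, of "\<tau> - s"]
  proof eventually_elim
    case (elim \<theta>)
    show ?case
    proof
      assume "0 \<le> \<theta> \<and> \<theta> < \<tau>"
      with elim s show "AE x in N. g (\<theta>, x) = f (\<theta>, x)"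
        by (auto simp: g_def add_diff_eq)
    qed
  qed
  then have gf: "AE p in augmented_space \<tau> X. g p = f p"
    by (intro IN.AE_pair_measure) measurable
  have "integrable (augmented_space \<tau> X) (\<lambda>p. cmod (f p) powr r)"
    using f by (simp add: Lr_space_def)
  also have "?this \<longleftrightarrow> integrable (augmented_space \<tau> X) (\<lambda>p. cmod (g p) powr r)"
    using gf by (intro integrable_cong_AE) auto
  finally have "g \<in> aug.L"
    by (simp add: Lr_space_def)
  moreover have "slices_continuous r \<tau> X g"
    unfolding slices_continuous_def
  proof
    fix \<theta>
    \<comment> \<open>At multiples of \<open>\<tau>\<close> the map \<open>rmod\<close> jumps.
      Adding \<open>m\<close> whole periods moves a neighbourhood of \<open>\<theta>\<close> beyond
      \<open>\<tau>\<close>, where \<open>g_slice\<close> rewrites the slices as values of the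
      continuous curve \<open>y\<close>.\<close>
    obtain m :: nat where m: "\<tau> - \<theta> < of_nat m * \<tau>"
      using reals_Archimedean3[OF period] by blast
    define b where "b = of_nat m * \<tau>"
    have rmod_b: "(t + b) rmod \<tau> = t rmod \<tau>" for t
      using rmod_add[of t \<tau> b] by (simp add: b_def)
    have "filterlim (\<lambda>\<eta>. \<eta> + b - s) (at (\<theta> + b - s)) (at \<theta>)"
      unfolding filterlim_at by (auto simp: eventually_at_filter intro!: tendsto_eq_intros)
    moreover have "tends y (y (\<theta> + b - s)) (at (\<theta> + b - s))"
      using m s by (intro y_cont) (simp add: b_def)
    ultimately have "tends (\<lambda>\<eta>. y (\<eta> + b - s)) (y (\<theta> + b - s)) (at \<theta>)"
      by (rule tends_compose[rotated])
    then show "tends (\<lambda>\<eta> x. g (\<eta> rmod \<tau>, x)) (\<lambda>x. g (\<theta> rmod \<tau>, x)) (at \<theta>)"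
    proof (rule tends_cong)
      have eq: "AE x in N. y (\<eta> + b - s) x = g (\<eta> rmod \<tau>, x)" if "\<eta> > \<tau> - b" for \<eta>
        using g_slice[of "\<eta> + b"] that by (simp add: rmod_b)
      show "AE x in N. y (\<theta> + b - s) x = g (\<theta> rmod \<tau>, x)"
        using m by (intro eq) (simp add: b_def)
      have "eventually (\<lambda>\<eta>. \<eta> \<in> {\<tau> - b<..}) (at \<theta>)"
        using m by (intro eventually_at_in_open') (auto simp: b_def)
      then show "eventually (\<lambda>\<eta>. (\<lambda>x. g (\<eta> rmod \<tau>, x)) \<in> L \<and>
          (AE x in N. y (\<eta> + b - s) x = g (\<eta> rmod \<tau>, x))) (at \<theta>)"
        by eventually_elim (simp add: g_L eq)
    qed (rule g_L)
  qed
  ultimately show ?thesis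
    using gf unfolding continuous_version_def by blast
qed

end

theorem lemma22:
  fixes X :: "'a::euclidean_space set"
    and \<tau> \<epsilon> r :: real
    and v :: "real \<Rightarrow> 'a \<Rightarrow> 'a"
    and M :: "'w measure" and F :: "real \<Rightarrow> 'w measure" and w :: "real \<Rightarrow> 'w \<Rightarrow> 'a"
    and q :: "real \<Rightarrow> real \<Rightarrow> 'a \<Rightarrow> 'a \<Rightarrow> real"
    and qf :: "real \<Rightarrow> real \<Rightarrow> real \<Rightarrow> 'a \<Rightarrow> 'a \<Rightarrow> real"
    and P :: "real \<Rightarrow> real \<Rightarrow> ('a \<Rightarrow> complex) \<Rightarrow> 'a \<Rightarrow> complex"
    and G :: "real \<Rightarrow> ('a \<Rightarrow> complex) \<Rightarrow> ('a \<Rightarrow> complex) \<Rightarrow> bool"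
    and \<mu> :: complex
    and f :: "real \<times> 'a \<Rightarrow> complex"
  assumes "\<tau> > 0" and "\<epsilon> > 0" and "1 \<le> r"
    and "bounded X" and "Ck_regular_domain 4 X"
    and "admissible_field \<tau> X v"
    and "standard_wiener_process M F w"
    and "transition_density M F w X v \<epsilon> q"
    and "\<And>\<theta>. \<theta> \<in> {0..<\<tau>} \<Longrightarrow> transition_density M F w X (\<lambda>_. v \<theta>) \<epsilon> (qf \<theta>)"
    and P_def: "P = transfer_op X q"
    and G_def: "G = frozen_generator r X qf"
    and fokker_planck: "evolution_family (leb_on X) r (\<lambda>t. G (t rmod \<tau>)) P"
  shows
    "(augmented_generator r \<tau> X P f (\<lambda>p. \<mu> * f p) \<longrightarrow>
        (\<exists>g. continuous_version r \<tau> X f g) \<and>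
        (\<forall>g. continuous_version r \<tau> X f g \<longrightarrow> eigenslices \<tau> X P \<mu> g)) \<and>
     (classical_augmented_generator r \<tau> X G f (\<lambda>p. \<mu> * f p) \<longrightarrow> eigenslices \<tau> X P \<mu> f)"
proof -
  have "open X"
    using assms by (simp add: Ck_regular_domain_def)
  interpret augmented_evolution X r G \<tau> q
  proof
    show "evolution_family (leb_on X) r (\<lambda>t. G (t rmod \<tau>)) (transfer_op X q)"
      using fokker_planck unfolding P_def .
    show "G \<theta> h k \<Longrightarrow> k \<in> Lr_space (leb_on X) r" for \<theta> h k
      by (simp add: G_def frozen_generator_def generates_def Lr_tendsto_def)
    show "X \<in> sets borel"
      using \<open>open X\<close> by simp
    show "emeasure lborel X < \<infinity>"
      using \<open>bounded X\<close> by (rule emeasure_bounded_finite)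
    show "set_borel_measurable borel {(s, t, y, z). 0 \<le> s \<and> s < t \<and> y \<in> X \<and> z \<in> X}
       (\<lambda>(s, t, y, z). q s t y z)"
      using assms unfolding transition_density_def by blast
  qed (fact assms)+
  show ?thesis
    unfolding P_def
    using continuous_version_exists eigenslices_if_generator eigenslices_if_classical by blast
qed

end
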